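(* Let $N\ge 1$ and $K=\mathbb{Q}(\Gamma_N)$. The $K$-linear map $\zeta_{\mathcal{A}(N),\ast}\colon \mathfrak{A}_N^1\to \mathcal{A}(N)$ defined on words by $\zeta_{\mathcal{A}(N),\ast}(y_{s_1,\eta_1}\cdots y_{s_d,\eta_d}):=\zeta_{\mathcal{A}(N)}\binom{s_1,\dots,s_d}{\eta_1,\dots,\eta_d}$ (and sending the empty word to $1$) is an algebra homomorphism $(\mathfrak{A}_N^1,\ast)\to\mathcal{A}(N)$, i.e. $\zeta_{\mathcal{A}(N),\ast}(u\ast v)=\zeta_{\mathcal{A}(N),\ast}(u)\,\zeta_{\mathcal{A}(N),\ast}(v)$ for all $u,v\in\mathfrak{A}_N^1$.
   Context: Fix $N\ge1$. $\Gamma_N\subset\mathbb{C}$ is the group of $N$th roots of unity, $\xi_N\in\Gamma_N$ a fixed primitive one, $K=\mathbb{Q}(\Gamma_N)=\mathbb{Q}(\xi_N)$. The ring $\mathcal{A}(N)$: let $\mathcal{P}(N)$ be the set of primes $p$ with $p\equiv -1 \pmod N$. For each $p\in\mathcal{P}(N)$ fix a primitive $N$th root of unity $\xi_{N,p}$ in an algebraic closure of $\mathbb{F}_p$ and let $\mathbb{F}_p[\xi_N]:=\{\sum_{j=0}^{N-1}c_j\xi_{N,p}^j: c_j\in\mathbb{F}_p\}$ be the ring it generates over $\mathbb{F}_p$. Put $\mathcal{A}(N):=\prod_{p\in\mathcal{P}(N)}\mathbb{F}_p[\xi_N]\big/\bigoplus_{p\in\mathcal{P}(N)}\mathbb{F}_p[\xi_N]$.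 It is a $K$-algebra via the embedding sending $\sum_{j=0}^{N-1} a_j\xi_N^j$ ($a_j\in\mathbb{Q}$) to the class of $(\sum_j \phi_p(a_j)\xi_{N,p}^j)_p$, where $\phi_p(a)=a \bmod p$ if $\mathrm{ord}_p(a)\ge0$ (or $a=0$) and $\phi_p(a)=0$ otherwise. Finite colored multiple zeta values: for $\mathbf{s}=(s_1,\dots,s_d)\in\mathbb{N}^d$ ($\mathbb{N}$ = positive integers) and $\boldsymbol\eta=(\eta_1,\dots,\eta_d)\in\Gamma_N^d$, $$\zeta_{\mathcal{A}(N)}\binom{\mathbf{s}}{\boldsymbol\eta}:=\Big(\sum_{p>k_1>\cdots>k_d>0}\frac{\eta_1^{k_1}\cdots\eta_d^{k_d}}{k_1^{s_1}\cdots k_d^{s_d}}\Big)_{p\in\mathcal{P}(N)}\in\mathcal{A}(N),$$ where in the $p$-component $\eta_j=\xi_N^{e_j}$ is read as $\xi_{N,p}^{e_j}$. Words: $\mathfrak{A}_N^1$ is the free noncommutative polynomial algebra over $K$ on the letters $y_{m,\mu}$, $m\in\mathbb{N}$, $\mu\in\Gamma_N$; $1$ denotes the empty word. The stuffle product $\ast$ on $\mathfrak{A}_N^1$ is the bilinear product defined by $1\ast w=w\ast 1=w$ and $y_{m,\mu}u\ast y_{n,\nu}v=y_{m,\mu}(u\ast y_{n,\nu}v)+y_{n,\nu}(y_{m,\mu}u\ast v)+y_{m+n,\mu\nu}(u\ast v)$ for words $u,v,w$. *)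

theory Defs
  imports
    "HOL-Library.Poly_Mapping"
    "HOL-Algebra.Algebra"
    "HOL-Algebra.Algebraic_Closure_Type"
    "HOL-Number_Theory.Residues"
begin

section \<open>Roots of unity and the coefficient field\<close>

definition primitive_root :: "('a, 'b) ring_scheme \<Rightarrow> nat \<Rightarrow> 'a \<Rightarrow> bool" where
  "primitive_root R N x \<longleftrightarrow>
     x \<in> carrier R \<and> x [^]\<^bsub>R\<^esub> N = \<one>\<^bsub>R\<^esub> \<and> (\<forall>m. 0 < m \<and> m < N \<longrightarrow> x [^]\<^bsub>R\<^esub> m \<noteq> \<one>\<^bsub>R\<^esub>)"

abbreviation complex_ring :: "complex ring" where
  "complex_ring \<equiv> ring_of_type_algebra"

definition Gamma :: "nat \<Rightarrow> complex set" where
  "Gamma N = {z. z ^ N = 1}"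

definition cyc_field :: "nat \<Rightarrow> complex set" where
  "cyc_field N = generate_field complex_ring (Gamma N)"


section \<open>The ring A(N)\<close>

text \<open>
  The algebraic closures of the prime fields and the primitive roots in them are arbitrary choices.
  They enter as parameters: \<open>L p\<close> is the closure of the field with \<open>p\<close> elements and \<open>x p\<close> is the
  chosen primitive \<open>N\<close>th root of unity in \<open>L p\<close>. Likewise \<open>xi\<close> is the chosen primitive
  \<open>N\<close>th root of unity in the complex numbers.
\<close>

definition PN :: "nat \<Rightarrow> nat set" where
  "PN N = {p. Factorial_Ring.prime p \<and> [int p = - 1] (mod int N)}"

definition is_alg_closure_of :: "('a, 'b) ring_scheme \<Rightarrow> ('c, 'd) ring_scheme \<Rightarrow> bool" where
  "is_alg_closure_of F L \<longleftrightarrow> (\<exists>h \<in> ring_hom F L. algebraic_closure L (h ` carrier F))"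

text \<open>
  Inside a field of characteristic \<open>p\<close> the prime field consists of the integer multiples of 1, so
  coefficients from it are written as integers.
\<close>

definition Fp_adjoin :: "nat \<Rightarrow> 'a ring \<Rightarrow> 'a \<Rightarrow> 'a ring" where
  "Fp_adjoin N R y =
     R\<lparr>carrier := {\<Oplus>\<^bsub>R\<^esub>j\<in>{..<N}. ([c j] \<cdot>\<^bsub>R\<^esub> \<one>\<^bsub>R\<^esub>) \<otimes>\<^bsub>R\<^esub> (y [^]\<^bsub>R\<^esub> j) | c :: nat \<Rightarrow> int. True}\<rparr>"

definition product_ring :: "'i set \<Rightarrow> ('i \<Rightarrow> 'a ring) \<Rightarrow> ('i \<Rightarrow> 'a) ring" where
  "product_ring I R =
     \<lparr>carrier = (\<Pi>\<^sub>E i\<in>I. carrier (R i)),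
      monoid.mult = (\<lambda>f g. \<lambda>i\<in>I. f i \<otimes>\<^bsub>R i\<^esub> g i),
      one = (\<lambda>i\<in>I. \<one>\<^bsub>R i\<^esub>),
      ring.zero = (\<lambda>i\<in>I. \<zero>\<^bsub>R i\<^esub>),
      add = (\<lambda>f g. \<lambda>i\<in>I. f i \<oplus>\<^bsub>R i\<^esub> g i)\<rparr>"

definition direct_sum_ideal :: "'i set \<Rightarrow> ('i \<Rightarrow> 'a ring) \<Rightarrow> ('i \<Rightarrow> 'a) set" where
  "direct_sum_ideal I R =
     {f \<in> carrier (product_ring I R). finite {i \<in> I. f i \<noteq> \<zero>\<^bsub>R i\<^esub>}}"

definition AN_product :: "nat \<Rightarrow> (nat \<Rightarrow> 'a ring) \<Rightarrow> (nat \<Rightarrow> 'a) \<Rightarrow> (nat \<Rightarrow> 'a) ring" where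
  "AN_product N L x = product_ring (PN N) (\<lambda>p. Fp_adjoin N (L p) (x p))"

definition AN_ideal :: "nat \<Rightarrow> (nat \<Rightarrow> 'a ring) \<Rightarrow> (nat \<Rightarrow> 'a) \<Rightarrow> (nat \<Rightarrow> 'a) set" where
  "AN_ideal N L x = direct_sum_ideal (PN N) (\<lambda>p. Fp_adjoin N (L p) (x p))"

definition AN_ring :: "nat \<Rightarrow> (nat \<Rightarrow> 'a ring) \<Rightarrow> (nat \<Rightarrow> 'a) \<Rightarrow> (nat \<Rightarrow> 'a) set ring" where
  "AN_ring N L x = AN_product N L x Quot AN_ideal N L x"

definition AN_class ::
  "nat \<Rightarrow> (nat \<Rightarrow> 'a ring) \<Rightarrow> (nat \<Rightarrow> 'a) \<Rightarrow> (nat \<Rightarrow> 'a) \<Rightarrow> (nat \<Rightarrow> 'a) set" where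
  "AN_class N L x f = AN_ideal N L x +>\<^bsub>AN_product N L x\<^esub> (\<lambda>p\<in>PN N. f p)"

text \<open>
  \<open>quotient_of\<close> gives the reduced fraction, so \<open>ord\<^sub>p a \<ge> 0\<close> (or \<open>a = 0\<close>) says that \<open>p\<close> does
  not divide its denominator.
\<close>

definition rat_red :: "nat \<Rightarrow> 'a ring \<Rightarrow> rat \<Rightarrow> 'a" where
  "rat_red p R a =
     (let (n, d) = quotient_of a in
      if int p dvd d then \<zero>\<^bsub>R\<^esub>
      else ([n] \<cdot>\<^bsub>R\<^esub> \<one>\<^bsub>R\<^esub>) \<otimes>\<^bsub>R\<^esub> inv\<^bsub>R\<^esub> ([d] \<cdot>\<^bsub>R\<^esub> \<one>\<^bsub>R\<^esub>))"

text \<open>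
  The class does not depend on the representation of \<open>c\<close> in the powers of \<open>xi\<close>, because two
  representations give the same component at all but finitely many \<open>p\<close>.
\<close>

definition AN_embed ::
  "nat \<Rightarrow> complex \<Rightarrow> (nat \<Rightarrow> 'a ring) \<Rightarrow> (nat \<Rightarrow> 'a) \<Rightarrow> complex \<Rightarrow> (nat \<Rightarrow> 'a) set" where
  "AN_embed N xi L x c =
     (THE Y. \<exists>a :: nat \<Rightarrow> rat. c = (\<Sum>j<N. of_rat (a j) * xi ^ j) \<and>
        Y = AN_class N L x
              (\<lambda>p. \<Oplus>\<^bsub>L p\<^esub>j\<in>{..<N}. rat_red p (L p) (a j) \<otimes>\<^bsub>L p\<^esub> (x p [^]\<^bsub>L p\<^esub> j)))"

definition AN ::
  "nat \<Rightarrow> complex \<Rightarrow> (nat \<Rightarrow> 'a ring) \<Rightarrow> (nat \<Rightarrow> 'a) \<Rightarrow> (complex, (nat \<Rightarrow> 'a) set) module" where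
  "AN N xi L x =
     ring.extend (AN_ring N L x)
       (module.fields (\<lambda>c Y. AN_embed N xi L x c \<otimes>\<^bsub>AN_ring N L x\<^esub> Y))"


section \<open>Finite colored multiple zeta values\<close>

text \<open>The element \<open>xi ^ e\<close> of \<open>Gamma N\<close> is read as \<open>y [^] e\<close> in the field \<open>R\<close>.\<close>

definition root_red :: "nat \<Rightarrow> complex \<Rightarrow> 'a ring \<Rightarrow> 'a \<Rightarrow> complex \<Rightarrow> 'a" where
  "root_red N xi R y eta = y [^]\<^bsub>R\<^esub> (THE e. e < N \<and> eta = xi ^ e)"

definition decreasing_tuples :: "nat \<Rightarrow> nat \<Rightarrow> nat list set" where
  "decreasing_tuples p d =
     {ks. length ks = d \<and> sorted_wrt (>) ks \<and> (\<forall>k \<in> set ks. 0 < k \<and> k < p)}"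

definition fcmzv_component ::
  "nat \<Rightarrow> complex \<Rightarrow> nat \<Rightarrow> 'a ring \<Rightarrow> 'a \<Rightarrow> nat list \<Rightarrow> complex list \<Rightarrow> 'a" where
  "fcmzv_component N xi p R y ss etas =
     (\<Oplus>\<^bsub>R\<^esub>ks\<in>decreasing_tuples p (length ss).
        (\<Otimes>\<^bsub>R\<^esub>i\<in>{..<length ss}. root_red N xi R y (etas ! i) [^]\<^bsub>R\<^esub> (ks ! i)) \<otimes>\<^bsub>R\<^esub>
        inv\<^bsub>R\<^esub> (\<Otimes>\<^bsub>R\<^esub>i\<in>{..<length ss}. ([ks ! i] \<cdot>\<^bsub>R\<^esub> \<one>\<^bsub>R\<^esub>) [^]\<^bsub>R\<^esub> (ss ! i)))"

definition fcmzv ::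
  "nat \<Rightarrow> complex \<Rightarrow> (nat \<Rightarrow> 'a ring) \<Rightarrow> (nat \<Rightarrow> 'a) \<Rightarrow> nat list \<Rightarrow> complex list
     \<Rightarrow> (nat \<Rightarrow> 'a) set" where
  "fcmzv N xi L x ss etas = AN_class N L x (\<lambda>p. fcmzv_component N xi p (L p) (x p) ss etas)"


section \<open>The stuffle algebra\<close>

text \<open>
  The letter with indices \<open>m\<close> and \<open>mu\<close> is the pair \<open>(m, mu)\<close>. A noncommutative polynomial is a
  finitely supported function from words to coefficients.
\<close>

type_synonym word = "(nat \<times> complex) list"
type_synonym ncpoly = "word \<Rightarrow>\<^sub>0 complex"

definition letters :: "nat \<Rightarrow> (nat \<times> complex) set" where
  "letters N = {0<..} \<times> Gamma N"

definition scale :: "complex \<Rightarrow> ncpoly \<Rightarrow> ncpoly" where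
  "scale c f = Poly_Mapping.map ((*) c) f"

definition prepend :: "nat \<times> complex \<Rightarrow> ncpoly \<Rightarrow> ncpoly" where
  "prepend a f = (\<Sum>w\<in>Poly_Mapping.keys f. Poly_Mapping.single (a # w) (Poly_Mapping.lookup f w))"

fun stuffle_words :: "word \<Rightarrow> word \<Rightarrow> ncpoly" where
  "stuffle_words [] w = Poly_Mapping.single w 1"
| "stuffle_words w [] = Poly_Mapping.single w 1"
| "stuffle_words ((m, mu) # u) ((n, nu) # v) =
     prepend (m, mu) (stuffle_words u ((n, nu) # v))
   + prepend (n, nu) (stuffle_words ((m, mu) # u) v)
   + prepend (m + n, mu * nu) (stuffle_words u v)"

definition stuffle :: "ncpoly \<Rightarrow> ncpoly \<Rightarrow> ncpoly" where
  "stuffle f g =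
     (\<Sum>u\<in>Poly_Mapping.keys f. \<Sum>v\<in>Poly_Mapping.keys g.
        scale (Poly_Mapping.lookup f u * Poly_Mapping.lookup g v) (stuffle_words u v))"

definition stuffle_algebra :: "nat \<Rightarrow> (complex, ncpoly) module" where
  "stuffle_algebra N =
     \<lparr>carrier = {f. \<forall>w \<in> Poly_Mapping.keys f.
                      w \<in> lists (letters N) \<and> Poly_Mapping.lookup f w \<in> cyc_field N},
      monoid.mult = stuffle,
      one = Poly_Mapping.single [] 1,
      ring.zero = 0,
      add = (+),
      module.smult = scale\<rparr>"

definition zeta_star ::
  "nat \<Rightarrow> complex \<Rightarrow> (nat \<Rightarrow> 'a ring) \<Rightarrow> (nat \<Rightarrow> 'a) \<Rightarrow> ncpoly \<Rightarrow> (nat \<Rightarrow> 'a) set" where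
  "zeta_star N xi L x f =
     (\<Oplus>\<^bsub>AN N xi L x\<^esub>w\<in>Poly_Mapping.keys f.
        Poly_Mapping.lookup f w \<odot>\<^bsub>AN N xi L x\<^esub>
          (if w = [] then \<one>\<^bsub>AN N xi L x\<^esub> else fcmzv N xi L x (map fst w) (map snd w)))"

end

theory Submission
  imports Defs
begin

text \<open>
  For a fixed prime \<open>p\<close>, replace the upper bound \<open>p\<close> of the summation by an arbitrary \<open>n \<le> p\<close>.
  Splitting off the terms with \<open>k\<^sub>1 = n\<close> gives a recursion in \<open>n\<close>, and multiplying two such
  recursions yields the three terms of the stuffle recursion; so the stuffle relation holds in each
  component, by induction on \<open>n\<close>.

  The coefficient field embeds into \<open>A(N)\<close> for the following reason. If an integral polynomial
  \<open>f\<close> vanishes at \<open>xi\<close>, then, as cyclotomic polynomials are irreducible, it vanishes at all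
  primitive \<open>N\<close>th roots of unity, so \<open>X\<^sup>N - 1\<close> divides the product of \<open>f\<close> and all
  \<open>X\<^sup>d - 1\<close>, \<open>0 < d < N\<close>. Evaluated at a primitive \<open>N\<close>th root of unity in characteristic
  \<open>p\<close>, this shows that \<open>f\<close> vanishes there as well.
\<close>

section \<open>Integral polynomials vanishing at a root of unity\<close>

text \<open>The stuffle relation already holds at every single prime of \<open>PN N\<close>; most of
  the effort goes into the \<open>K\<close>-structure. Scalars act through \<open>AN_embed\<close>,
  a definite description over all rational representations of \<open>c\<close> in the powers 1, ...,
  xi^(N-1). For N > 1 these powers are linearly dependent, so representations are not unique, and
  the action makes sense only because every integral relation f(xi) = 0 persists at
  \<open>x p\<close>. Compatibility with sums and products of coefficients rests on the same fact.
  The factors X^d - 1 stand in for the cofactor of the Nth cyclotomic polynomial in X^N - 1. No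
  cyclotomic polynomial and no reduction of one modulo p has to be named: in a field, the product of
  these factors can be cancelled at any element of exact order N. Irreducibility is used only in the
  form that f(xi) = 0 implies f(xi^k) = 0 for k coprime to N. This comes from the Frobenius
  congruence modulo large primes q and from a bound on the integers that divide a nonzero
  value.\<close>

lemma add_power_prime:
  fixes a b :: "'a :: comm_ring_1"
  assumes "Factorial_Ring.prime q"
  shows "\<exists>c. (a + b) ^ q = a ^ q + b ^ q + of_nat q * c"
proof -
  have q: "q > 0" using assms prime_gt_0_nat by blast
  have "\<exists>c. of_nat (q choose k) * a ^ k * b ^ (q - k) = of_nat q * c" if "k \<in> {1..<q}" for k
  proof -
    have "q dvd (q choose k)" using that assms by (intro dvd_choose_prime) auto
    then obtain m where "q choose k = q * m" by blast
    then have "of_nat (q choose k) * a ^ k * b ^ (q - k) = of_nat q * (of_nat m * a ^ k * b ^ (q - k))"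
      by (simp add: mult.assoc)
    then show ?thesis by blast
  qed
  then obtain c where c: "\<And>k. k \<in> {1..<q} \<Longrightarrow> of_nat (q choose k) * a ^ k * b ^ (q - k) = of_nat q * c k"
    by metis
  have "{..q} = insert 0 (insert q {1..<q})" using q by auto
  then have "(a + b) ^ q = b ^ q + (a ^ q + (\<Sum>k\<in>{1..<q}. of_nat (q choose k) * a ^ k * b ^ (q - k)))"
    unfolding binomial_ring using q by simp
  also have "(\<Sum>k\<in>{1..<q}. of_nat (q choose k) * a ^ k * b ^ (q - k)) = of_nat q * (\<Sum>k\<in>{1..<q}. c k)"
    by (simp add: c sum_distrib_left)
  finally have "(a + b) ^ q = a ^ q + b ^ q + of_nat q * (\<Sum>k\<in>{1..<q}. c k)"
    by (simp add: ac_simps)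
  then show ?thesis by blast
qed

text \<open>Frobenius modulo \<open>q\<close>, by induction along the coefficients:
  \<open>q\<close>th powers are additive modulo \<open>q\<close>, and Fermat's theorem makes
  \<open>a ^ q\<close> congruent to the coefficient \<open>a\<close> split off.\<close>

lemma pcompose_monom_prime:
  fixes f :: "int poly"
  assumes q: "Factorial_Ring.prime q"
  shows "\<exists>s. pcompose f (Polynomial.monom 1 q) = f ^ q + of_nat q * s"
proof (induction f)
  case 0
  have "q > 0" using assms prime_gt_0_nat by blast
  then show ?case by (intro exI[of _ 0]) (simp add: power_0_left)
next
  case (pCons a f)
  then obtain s where s: "pcompose f (Polynomial.monom 1 q) = f ^ q + of_nat q * s" by blast
  have "[a ^ q = a] (mod int q)"
  proof -
    have e: "q = Suc (q - 1)" using q prime_gt_0_nat by (metis Suc_diff_1)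
    show ?thesis
    proof (cases "int q dvd a")
      case True
      moreover have "int q dvd a ^ q" using True e by (metis dvd_mult2 power_Suc)
      ultimately show ?thesis by (simp add: cong_def mod_eq_0_iff_dvd)
    next
      case False
      \<comment> \<open>\<open>fermat_theorem\<close> speaks of natural numbers, so \<open>a\<close>
        is replaced by its nonnegative residue.\<close>
      define b where "b = nat (a mod int q)"
      have b: "[int b = a] (mod int q)" using q prime_gt_0_nat by (auto simp: b_def cong_def)
      have nd: "\<not> q dvd b"
        using False b by (metis cong_dvd_iff int_dvd_int_iff)
      have "[b ^ (q - 1) = 1] (mod q)" using q nd by (intro fermat_theorem) auto
      then have "[b ^ (q - 1) * b = 1 * b] (mod q)" by (rule cong_scalar_right)
      then have "[b ^ q = b] (mod q)" using e by (metis mult_1 power_Suc2)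
      then have "[int b ^ q = int b] (mod int q)" by (metis cong_int_iff of_nat_power)
      then show ?thesis using b by (meson cong_pow cong_sym cong_trans)
    qed
  qed
  then obtain k where k: "a ^ q + k * int q = a" by (metis cong_iff_lin mult.commute)
  obtain c where c: "([:a:] + [:0,1:] * f) ^ q = [:a:] ^ q + ([:0,1:] * f) ^ q + of_nat q * c"
    using add_power_prime[OF q, of "[:a:]" "[:0,1:] * f"] by blast
  have X: "[:0,1:] ^ q = (Polynomial.monom 1 q :: int poly)"
    by (simp add: monom_altdef)
  have A: "[:a:] = [:a:] ^ q + of_nat q * [:k:]"
    by (simp add: poly_const_pow of_nat_poly mult.commute[of "int q"] k)
  have "pcompose (pCons a f) (Polynomial.monom 1 q) = [:a:] + Polynomial.monom 1 q * (f ^ q + of_nat q * s)"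
    by (simp add: pcompose_pCons s)
  also have "\<dots> = [:a:] ^ q + of_nat q * [:k:] + Polynomial.monom 1 q * (f ^ q + of_nat q * s)"
    using A by simp
  also have "\<dots> = ([:a:] + [:0,1:] * f) ^ q + of_nat q * ([:k:] + Polynomial.monom 1 q * s - c)"
    unfolding c power_mult_distrib X by (simp add: algebra_simps)
  also have "[:a:] + [:0,1:] * f = pCons a f" by simp
  finally show ?case by blast
qed

text \<open>Coefficients stay integral although the point is complex, so that the same polynomial
  can also be evaluated in characteristic \<open>p\<close> by \<open>ring_eval\<close>.\<close>

definition int_eval :: "int poly \<Rightarrow> complex \<Rightarrow> complex" where
  "int_eval f z = Polynomial.poly (map_poly of_int f) z"

lemma int_eval_0 [simp]: "int_eval 0 z = 0"
  by (simp add: int_eval_def)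

lemma int_eval_pCons [simp]: "int_eval (pCons a f) z = of_int a + z * int_eval f z"
  by (simp add: int_eval_def map_poly_pCons)

lemma int_eval_1 [simp]: "int_eval 1 z = 1"
  by (simp add: one_pCons)

lemma int_eval_add [simp]: "int_eval (f + g) z = int_eval f z + int_eval g z"
  by (induction f g rule: poly_induct2) (simp_all add: algebra_simps)

lemma int_eval_smult [simp]: "int_eval (Polynomial.smult a f) z = of_int a * int_eval f z"
  by (induction f) (simp_all add: algebra_simps)

lemma int_eval_minus [simp]: "int_eval (- f) z = - int_eval f z"
  using int_eval_smult[of "-1" f z] by simp

lemma int_eval_diff [simp]: "int_eval (f - g) z = int_eval f z - int_eval g z"
  using int_eval_add[of f "- g" z] by simp

lemma int_eval_mult [simp]: "int_eval (f * g) z = int_eval f z * int_eval g z"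
  by (induction f) (simp_all add: algebra_simps)

lemma int_eval_power [simp]: "int_eval (f ^ n) z = int_eval f z ^ n"
  by (induction n) simp_all

lemma int_eval_of_nat [simp]: "int_eval (of_nat n) z = of_nat n"
  by (simp add: of_nat_poly)

lemma int_eval_prod [simp]: "int_eval (\<Prod>i\<in>A. f i) z = (\<Prod>i\<in>A. int_eval (f i) z)"
  by (induction A rule: infinite_finite_induct) simp_all

lemma int_eval_sum [simp]: "int_eval (\<Sum>i\<in>A. f i) z = (\<Sum>i\<in>A. int_eval (f i) z)"
  by (induction A rule: infinite_finite_induct) simp_all

lemma int_eval_monom [simp]: "int_eval (Polynomial.monom a n) z = of_int a * z ^ n"
  by (simp add: int_eval_def map_poly_monom poly_monom)

lemma int_eval_pcompose [simp]: "int_eval (pcompose f g) z = int_eval f (int_eval g z)"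
  by (induction f) (simp_all add: pcompose_pCons)

lemma int_eval_altdef: "int_eval f z = (\<Sum>i\<le>Polynomial.degree f. of_int (Polynomial.coeff f i) * z ^ i)"
  by (simp add: int_eval_def poly_altdef coeff_map_poly degree_map_poly)

section \<open>Bounded divisibility and conjugation of roots of unity\<close>

lemma common_denominator:
  fixes S :: "rat set"
  assumes "finite S"
  shows "\<exists>D::nat. D > 0 \<and> (\<forall>r\<in>S. \<exists>n. of_nat D * r = of_int n)"
  using assms
proof induction
  case empty
  show ?case by (intro exI[of _ 1]) auto
next
  case (insert r S)
  then obtain D :: nat where D: "D > 0" "\<And>r. r \<in> S \<Longrightarrow> \<exists>n. of_nat D * r = of_int n" by blast
  obtain a b where q: "quotient_of r = (a, b)" by fastforce
  have b: "b > 0" using quotient_of_denom_pos[OF q] .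
  have r: "r = of_int a / of_int b" using quotient_of_div[OF q] .
  have "\<exists>n. of_nat (D * nat b) * t = of_int n" if t: "t \<in> insert r S" for t
  proof (cases "t = r")
    case True
    have "of_nat (D * nat b) * t = of_int (int D * a)" using b True r by (simp add: field_simps)
    then show ?thesis by blast
  next
    case False
    then obtain n where "of_nat D * t = of_int n" using D(2)[of t] t by blast
    then have "of_nat (D * nat b) * t = of_int (b * n)" using b by (simp add: mult_ac)
    then show ?thesis by blast
  qed
  moreover have "D * nat b > 0" using D b by simp
  ultimately show ?case by blast
qed

text \<open>
  A \<open>\<rat>\<close>-linear functional on the complex numbers which is 1 at \<open>\<alpha>\<close> has bounded denominators on
  the ring generated by the roots of unity; this bounds the integers dividing \<open>\<alpha>\<close> in that ring.
\<close>

lemma divisors_bounded: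
  assumes "N \<ge> 1" and \<alpha>: "\<alpha> \<noteq> 0"
  shows "\<exists>D::nat. \<forall>q s z. z ^ N = 1 \<longrightarrow> \<alpha> = of_nat q * int_eval s z \<longrightarrow> q \<le> D"
proof -
  interpret vector_space_pair "\<lambda>(q::rat) (c::complex). of_rat q * c" "\<lambda>(q::rat) (c::rat). q * c"
    by unfold_locales (simp_all add: algebra_simps of_rat_add of_rat_mult)
  have "vs1.independent {\<alpha>}" using \<alpha> by simp
  then obtain \<phi> :: "complex \<Rightarrow> rat"
    where lin: "Vector_Spaces.linear (\<lambda>(q::rat) (c::complex). of_rat q * c) (\<lambda>(q::rat) (c::rat). q * c) \<phi>"
      and \<phi>1: "\<phi> \<alpha> = 1"
    using linear_independent_extend[of "{\<alpha>}" "\<lambda>_. 1"] by blast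
  note hom = lin[unfolded Vector_Spaces.linear_iff, THEN conjunct2, THEN conjunct2]
  have add: "\<phi> (a + b) = \<phi> a + \<phi> b" for a b
    by (rule hom[THEN conjunct1, rule_format])
  have scale: "\<phi> (of_rat r * a) = r * \<phi> a" for r a
    by (rule hom[THEN conjunct2, rule_format])
  have zero: "\<phi> 0 = 0" using add[of 0 0] by simp
  have scale_int: "\<phi> (of_int r * a) = of_int r * \<phi> a" for r a
    using scale[of "of_int r"] by simp
  have sum: "\<phi> (\<Sum>i\<in>A. h i) = (\<Sum>i\<in>A. \<phi> (h i))" for h :: "nat \<Rightarrow> complex" and A
    by (induction A rule: infinite_finite_induct) (simp_all add: zero add)
  \<comment> \<open>There are only finitely many \<open>N\<close>th roots of unity, so one
    \<open>D\<close> clears the denominators of \<open>\<phi>\<close> at all of them, independently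
    of \<open>q\<close>, \<open>s\<close> and \<open>z\<close>.\<close>
  have fin: "finite (\<phi> ` {z. z ^ N = 1})"
    using assms(1) by (intro finite_imageI finite_roots_unity) auto
  obtain D :: nat where D: "D > 0" "\<And>w. w ^ N = 1 \<Longrightarrow> \<exists>n. of_nat D * \<phi> w = of_int n"
    using common_denominator[OF fin] by blast
  have "q \<le> D" if z: "z ^ N = 1" and e: "\<alpha> = of_nat q * int_eval s z" for q s z
  proof -
    have "\<exists>n. of_nat D * \<phi> (z ^ i) = of_int n" for i
      by (rule D) (metis power_mult mult.commute power_one z)
    then obtain n where n: "\<And>i. of_nat D * \<phi> (z ^ i) = of_int (n i)" by metis
    \<comment> \<open>Apply \<open>D\<close> times \<open>\<phi>\<close> to the factorization of
      \<open>\<alpha>\<close>. Powers of \<open>z\<close> are again \<open>N\<close>th roots of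
      unity, so the right side becomes \<open>q\<close> times an integer, while the left side is
      \<open>D\<close>; hence \<open>q\<close> divides \<open>D\<close>.\<close>
    have "of_nat D = of_nat D * \<phi> \<alpha>" using \<phi>1 by simp
    also have "\<dots> = of_nat q * (of_nat D * \<phi> (int_eval s z))"
      using scale_int[of "int q" "int_eval s z"] unfolding e by simp
    also have "of_nat D * \<phi> (int_eval s z) =
        (\<Sum>i\<le>Polynomial.degree s. of_int (Polynomial.coeff s i) * (of_nat D * \<phi> (z ^ i)))"
      unfolding int_eval_altdef sum scale_int sum_distrib_left by (simp only: mult.left_commute)
    also have "\<dots> = of_int (\<Sum>i\<le>Polynomial.degree s. Polynomial.coeff s i * n i)"
      by (simp add: n)
    finally have "(of_int (int D) :: rat) = of_int (int q * (\<Sum>i\<le>Polynomial.degree s. Polynomial.coeff s i * n i))"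
      by simp
    then have "int D = int q * (\<Sum>i\<le>Polynomial.degree s. Polynomial.coeff s i * n i)"
      by (metis of_int_eq_iff)
    then have "int q dvd int D" by simp
    then have "q dvd D" by simp
    then show ?thesis using D(1) by (simp add: dvd_imp_le)
  qed
  then show ?thesis by blast
qed

text \<open>Since f(z) = 0, the Frobenius congruence makes f(z^q) equal to q s(z) for an integral
  polynomial s. If it were nonzero, it would lie in the finite set \<open>V\<close>, and
  \<open>divisors_bounded\<close> limits \<open>q\<close> for each element of \<open>V\<close>; the
  bound \<open>A\<close> is the largest of these limits.\<close>

lemma int_eval_root_power_prime:
  assumes N: "N \<ge> 1"
  shows "\<exists>A::nat. \<forall>q z. Factorial_Ring.prime q \<longrightarrow> q > A \<longrightarrow> z ^ N = 1 \<longrightarrow> int_eval f z = 0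
    \<longrightarrow> int_eval f (z ^ q) = 0"
proof -
  define V where "V = int_eval f ` {z. z ^ N = 1} - {0}"
  have "finite V" unfolding V_def using N by (intro finite_Diff finite_imageI finite_roots_unity) auto
  have "\<forall>\<alpha>\<in>V. \<exists>D::nat. \<forall>q s z. z ^ N = 1 \<longrightarrow> \<alpha> = of_nat q * int_eval s z \<longrightarrow> q \<le> D"
    using divisors_bounded[OF N] by (auto simp: V_def)
  then obtain D :: "complex \<Rightarrow> nat" where
    D: "\<And>\<alpha> q s z. \<alpha> \<in> V \<Longrightarrow> z ^ N = 1 \<Longrightarrow> \<alpha> = of_nat q * int_eval s z \<Longrightarrow> q \<le> D \<alpha>" by metis
  have "int_eval f (z ^ q) = 0"
    if q: "Factorial_Ring.prime q" "q > Max (insert 0 (D ` V))" and z: "z ^ N = 1" "int_eval f z = 0" for q z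
  proof (rule ccontr)
    assume nz: "int_eval f (z ^ q) \<noteq> 0"
    have "(z ^ q) ^ N = 1" by (metis power_mult mult.commute power_one z(1))
    then have V: "int_eval f (z ^ q) \<in> V" using nz by (simp add: V_def)
    obtain s where s: "pcompose f (Polynomial.monom 1 q) = f ^ q + of_nat q * s"
      using pcompose_monom_prime[OF q(1)] by blast
    have "int_eval f (z ^ q) = int_eval (pcompose f (Polynomial.monom 1 q)) z" by simp
    also have "\<dots> = of_nat q * int_eval s z"
      using q(1) prime_gt_0_nat[of q] by (simp add: s z(2) power_0_left)
    finally have "q \<le> D (int_eval f (z ^ q))" using D[OF V z(1)] by blast
    also have "\<dots> \<le> Max (insert 0 (D ` V))" using V \<open>finite V\<close> by (intro Max_ge) auto
    finally show False using q(2) by simp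
  qed
  then show ?thesis by blast
qed

text \<open>
  Landau's proof of the irreducibility of cyclotomic polynomials: modulo \<open>N\<close>, every exponent prime
  to \<open>N\<close> has a representative all of whose prime factors exceed a given bound.
\<close>

lemma int_eval_root_power_coprime:
  assumes N: "N \<ge> 1" and z: "z ^ N = 1" "int_eval f z = 0" and k: "coprime k N"
  shows "int_eval f (z ^ k) = 0"
proof -
  obtain A :: nat where A: "\<And>q z. Factorial_Ring.prime q \<Longrightarrow> q > A \<Longrightarrow> z ^ N = 1 \<Longrightarrow>
      int_eval f z = 0 \<Longrightarrow> int_eval f (z ^ q) = 0"
    using int_eval_root_power_prime[OF N, of f] by blast
  \<comment> \<open>Strip off one prime factor \<open>q\<close> of the exponent at a time:
    \<open>w ^ q\<close> is again a root of \<open>f\<close> and an \<open>N\<close>th root of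
    unity.\<close>
  have gen: "int_eval f (w ^ m) = 0"
    if "m > 0" "\<And>q. Factorial_Ring.prime q \<Longrightarrow> q dvd m \<Longrightarrow> q > A" "w ^ N = 1" "int_eval f w = 0" for m w
    using that
  proof (induction m arbitrary: w rule: less_induct)
    case (less m)
    show ?case
    proof (cases "m = 1")
      case False
      then obtain q where q: "Factorial_Ring.prime q" "q dvd m" by (meson prime_factor_nat)
      then obtain r where r: "m = q * r" by blast
      have r0: "r > 0" "r < m" using less.prems(1) r prime_gt_1_nat[OF q(1)] by auto
      have "int_eval f (w ^ q) = 0" using A q less.prems by blast
      moreover have "(w ^ q) ^ N = 1" by (metis power_mult mult.commute power_one less.prems(3))
      ultimately have "int_eval f ((w ^ q) ^ r) = 0"
        using less.IH[OF r0(2) r0(1)] less.prems(2) r by auto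
      then show ?thesis by (simp add: r power_mult)
    qed (use less.prems in simp)
  qed
  define P where "P = {q. Factorial_Ring.prime q \<and> q \<le> A \<and> \<not> q dvd k}"
  have P: "finite P" by (rule finite_subset[of _ "{..A}"]) (auto simp: P_def)
  \<comment> \<open>Each prime \<open>q \<le> A\<close> divides exactly one of the two summands: if
    it divides \<open>k\<close>, it divides neither \<open>N\<close>, by coprimality, nor a prime in
    \<open>P\<close>; otherwise it lies in \<open>P\<close>. So no such prime divides
    \<open>m\<close>, while \<open>z ^ m = z ^ k\<close>.\<close>
  define m where "m = k + N * \<Prod>P"
  have "q > A" if q: "Factorial_Ring.prime q" "q dvd m" for q
  proof (rule ccontr)
    assume le: "\<not> q > A"
    show False
    proof (cases "q dvd k")
      case True
      then have "q dvd N * \<Prod>P" using q(2) by (simp add: m_def dvd_add_right_iff)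
      moreover have "\<not> q dvd N"
        using True k q(1) by (metis coprime_common_divisor_nat not_prime_1 nat_dvd_1_iff_1 coprime_def)
      ultimately have "q dvd \<Prod>P" using q(1) prime_dvd_mult_iff by blast
      then obtain r where "r \<in> P" "q dvd r"
        using q(1) P by (metis prime_dvd_prod_iff)
      then show False using True q(1) by (metis P_def mem_Collect_eq primes_dvd_imp_eq)
    next
      case False
      then have "q \<in> P" using q le by (simp add: P_def)
      then have "q dvd N * \<Prod>P" using dvd_prodI[OF P, of q "\<lambda>r. r"] by (intro dvd_mult) simp
      then show False using False q(2) by (simp add: m_def dvd_add_left_iff)
    qed
  qed
  moreover have "m > 0"
  proof -
    have "\<Prod>P > 0" by (rule prod_pos) (auto simp: P_def prime_gt_0_nat)
    then show ?thesis using N by (simp add: m_def)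
  qed
  ultimately have "int_eval f (z ^ m) = 0" using gen z by blast
  moreover have "z ^ m = z ^ k" by (simp add: m_def power_add power_mult z(1))
  ultimately show ?thesis by simp
qed

section \<open>Divisibility by X^N - 1 over the integers\<close>

lemma primitive_root_complex_ring_iff:
  "primitive_root complex_ring N xi \<longleftrightarrow> xi ^ N = 1 \<and> (\<forall>m. 0 < m \<and> m < N \<longrightarrow> xi ^ m \<noteq> 1)"
proof -
  have "xi [^]\<^bsub>complex_ring\<^esub> n = xi ^ n" for n :: nat
    by (induction n) (simp_all add: ring_of_type_algebra_def nat_pow_def)
  then show ?thesis by (simp add: primitive_root_def) (simp add: ring_of_type_algebra_def)
qed

lemma inj_on_root_powers:
  fixes xi :: complex
  assumes "xi ^ N = 1" "\<And>m. 0 < m \<Longrightarrow> m < N \<Longrightarrow> xi ^ m \<noteq> 1"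
  shows "inj_on (\<lambda>k. xi ^ k) {..<N}"
proof (rule linorder_inj_onI)
  fix i j assume ij: "i < j" "i \<in> {..<N}" "j \<in> {..<N}"
  have "xi \<noteq> 0" using assms(1) ij by (auto simp: power_0_left)
  then have "xi ^ i = xi ^ j \<longleftrightarrow> xi ^ (j - i) = 1"
    using ij by (simp add: power_diff) (auto simp: field_simps)
  then show "xi ^ i \<noteq> xi ^ j" using assms(2)[of "j - i"] ij by auto
qed auto

text \<open>X^N - 1 is monic, so pseudo-division is genuine division over the integers. At any point
  whose \<open>N\<close>th power is 1, \<open>f\<close> and \<open>r\<close> take the same
  value.\<close>

lemma division_by_monom_diff_1:
  fixes f :: "int poly"
  assumes N: "N \<ge> 1"
  obtains q r where "f = (Polynomial.monom 1 N - 1) * q + r" "Polynomial.degree r < N"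
proof -
  define M :: "int poly" where "M = Polynomial.monom 1 N - 1"
  have coM: "Polynomial.coeff M N = 1"
    using N by (simp add: M_def)
  have degM: "Polynomial.degree M = N"
  proof (rule antisym)
    show "Polynomial.degree M \<le> N"
      unfolding M_def by (intro degree_diff_le) (simp_all add: degree_monom_le)
    show "N \<le> Polynomial.degree M" using coM by (intro le_degree) simp
  qed
  have M0: "M \<noteq> 0" using coM by auto
  obtain q r where qr: "pseudo_divmod f M = (q, r)" by fastforce
  show ?thesis
    using that[of q r] pseudo_divmod[OF M0 qr] coM degM N by (auto simp: M_def)
qed

text \<open>Every power \<open>xi ^ k\<close> is a root of the product. If \<open>k\<close> is
  coprime to \<open>N\<close>, it is a root of \<open>f\<close> by conjugation; otherwise its order
  divides N / gcd(k, N), a proper divisor of \<open>N\<close> and hence one of the exponents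
  \<open>d\<close>. The remainder modulo X^N - 1 then has \<open>N\<close> distinct roots but degree
  below \<open>N\<close>, so it is 0.\<close>

lemma dvd_vanishing_int_poly:
  fixes f :: "int poly"
  assumes N: "N \<ge> 1" and prim: "primitive_root complex_ring N xi" and f: "int_eval f xi = 0"
  shows "(Polynomial.monom 1 N - 1) dvd f * (\<Prod>d\<in>{1..<N}. Polynomial.monom 1 d - 1)"
proof -
  define P where "P = f * (\<Prod>d\<in>{1..<N}. Polynomial.monom 1 d - 1)"
  have xi: "xi ^ N = 1" "\<And>m. 0 < m \<Longrightarrow> m < N \<Longrightarrow> xi ^ m \<noteq> 1"
    using prim by (simp_all add: primitive_root_complex_ring_iff)
  obtain q r where div: "P = (Polynomial.monom 1 N - 1) * q + r" "Polynomial.degree r < N"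
    using division_by_monom_diff_1[OF N] .
  have rt: "int_eval r (xi ^ k) = 0" for k
  proof -
    have "(xi ^ k) ^ N = 1"
      by (metis power_mult mult.commute power_one xi(1))
    moreover have "int_eval P (xi ^ k) = 0"
    proof (cases "coprime k N")
      case True
      then show ?thesis using int_eval_root_power_coprime[OF N xi(1) f] by (simp add: P_def)
    next
      case False
      define g where "g = gcd k N"
      have g: "g \<noteq> 1" "g > 0" "g dvd N" "g dvd k" using False N by (auto simp: g_def coprime_iff_gcd_eq_1)
      then obtain d e where d: "N = g * d" "k = g * e" by blast
      have "(xi ^ k) ^ d = (xi ^ N) ^ e" by (simp add: d flip: power_mult) (simp add: mult_ac)
      then have "(xi ^ k) ^ d = 1" by (simp add: xi)
      moreover have "d \<in> {1..<N}" using d N g by auto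
      ultimately show ?thesis by (auto simp: P_def)
    qed
    ultimately show ?thesis using div(1) by simp
  qed
  have "r = 0"
  proof (rule ccontr)
    assume "r \<noteq> 0"
    define R where "R = map_poly (of_int :: int \<Rightarrow> complex) r"
    have R: "R \<noteq> 0" "Polynomial.degree R < N"
      using \<open>r \<noteq> 0\<close> div(2) by (simp_all add: R_def degree_map_poly map_poly_eq_0_iff)
    have "N = card ((\<lambda>k. xi ^ k) ` {..<N})" by (simp add: card_image inj_on_root_powers[OF xi])
    also have "\<dots> \<le> card {x. Polynomial.poly R x = 0}"
      using rt R by (intro card_mono poly_roots_finite) (auto simp: R_def int_eval_def)
    also have "\<dots> \<le> Polynomial.degree R" using R by (intro card_poly_roots_bound)
    finally show False using R by simp
  qed
  then show ?thesis using div(1) by (simp add: P_def)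
qed

section \<open>Evaluation of integral polynomials in characteristic \<open>p\<close>\<close>

context ring begin

lemma int_embed_closed [simp, intro]: "[(k::int)] \<cdot> \<one> \<in> carrier R"
  by simp

lemma int_embed_0: "[(0::int)] \<cdot> \<one> = \<zero>"
  by (simp add: add_pow_int_ge)

lemma int_embed_1: "[(1::int)] \<cdot> \<one> = \<one>"
  by (simp add: add_pow_int_ge)

lemma int_embed_add: "[(a + b::int)] \<cdot> \<one> = [a] \<cdot> \<one> \<oplus> [b] \<cdot> \<one>"
  by (rule add.int_pow_mult) simp

lemma int_embed_mult: "[(a * b::int)] \<cdot> \<one> = [a] \<cdot> \<one> \<otimes> [b] \<cdot> \<one>"
proof -
  have "[a] \<cdot> \<one> \<otimes> [b] \<cdot> \<one> = [a] \<cdot> ([b] \<cdot> \<one>)" by (simp add: add_pow_ldistr_int)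
  also have "\<dots> = [(b * a)] \<cdot> \<one>" by (rule add.int_pow_pow) simp
  finally show ?thesis by (simp add: mult.commute)
qed

lemma int_embed_minus: "[(- a::int)] \<cdot> \<one> = \<ominus> ([a] \<cdot> \<one>)"
  by (rule add.int_pow_neg) simp

lemma int_embed_nat: "[(int n)] \<cdot> \<one> = [n] \<cdot> \<one>"
  by (simp add: add_pow_int_ge)

lemma int_embed_power: "[(a ^ n::int)] \<cdot> \<one> = ([a] \<cdot> \<one>) [^] n"
  by (induction n) (simp_all add: int_embed_1[simplified] int_embed_mult mult.commute[of a])

end

text \<open>Horner's scheme. It satisfies the same recursion along \<open>pCons\<close> as
  \<open>int_eval\<close>, so the homomorphism laws follow by the same inductions.\<close>

definition ring_eval :: "('a, 'b) ring_scheme \<Rightarrow> 'a \<Rightarrow> int poly \<Rightarrow> 'a" where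
  "ring_eval R y f = fold_coeffs (\<lambda>a r. [a] \<cdot>\<^bsub>R\<^esub> \<one>\<^bsub>R\<^esub> \<oplus>\<^bsub>R\<^esub> y \<otimes>\<^bsub>R\<^esub> r) f \<zero>\<^bsub>R\<^esub>"

context cring begin

lemma ring_eval_0 [simp]: "ring_eval R y 0 = \<zero>"
  by (simp add: ring_eval_def)

lemma ring_eval_pCons [simp]:
  assumes "y \<in> carrier R"
  shows "ring_eval R y (pCons a f) = [a] \<cdot> \<one> \<oplus> y \<otimes> ring_eval R y f"
\<comment> \<open>\<open>pCons 0 0\<close> is the zero polynomial, on which
  \<open>fold_coeffs\<close> performs no step; there the recursion holds because both summands
  vanish.\<close>
proof (cases "a = 0 \<and> f = 0")
  case True
  then show ?thesis using assms by (simp add: int_embed_0)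
next
  case False
  then show ?thesis by (auto simp: ring_eval_def)
qed

lemma ring_eval_closed [simp, intro]: "y \<in> carrier R \<Longrightarrow> ring_eval R y f \<in> carrier R"
  by (induction f) simp_all

lemma ring_eval_1 [simp]: "y \<in> carrier R \<Longrightarrow> ring_eval R y 1 = \<one>"
  by (simp add: one_pCons int_embed_1)

lemma ring_eval_add [simp]:
  assumes y: "y \<in> carrier R"
  shows "ring_eval R y (f + g) = ring_eval R y f \<oplus> ring_eval R y g"
proof (induction f g rule: poly_induct2)
  case (pCons a p b q)
  have "\<And>s t u v. s \<in> carrier R \<Longrightarrow> t \<in> carrier R \<Longrightarrow> u \<in> carrier R \<Longrightarrow> v \<in> carrier R \<Longrightarrow>
    (s \<oplus> t) \<oplus> y \<otimes> (u \<oplus> v) = (s \<oplus> y \<otimes> u) \<oplus> (t \<oplus> y \<otimes> v)"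
    using y by algebra
  then show ?case using y by (simp add: pCons int_embed_add)
qed simp

lemma ring_eval_smult [simp]:
  assumes y: "y \<in> carrier R"
  shows "ring_eval R y (Polynomial.smult a f) = [a] \<cdot> \<one> \<otimes> ring_eval R y f"
proof (induction f)
  case (pCons b f)
  have "\<And>s t u. s \<in> carrier R \<Longrightarrow> t \<in> carrier R \<Longrightarrow> u \<in> carrier R \<Longrightarrow>
    s \<otimes> t \<oplus> y \<otimes> (s \<otimes> u) = s \<otimes> (t \<oplus> y \<otimes> u)"
    using y by algebra
  then show ?case using y by (simp add: pCons int_embed_mult)
qed simp

lemma ring_eval_mult [simp]:
  assumes y: "y \<in> carrier R"
  shows "ring_eval R y (f * g) = ring_eval R y f \<otimes> ring_eval R y g"
proof (induction f)
  case (pCons a f)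
  have "\<And>s t u. s \<in> carrier R \<Longrightarrow> t \<in> carrier R \<Longrightarrow> u \<in> carrier R \<Longrightarrow>
    s \<otimes> u \<oplus> (\<zero> \<oplus> y \<otimes> (t \<otimes> u)) = (s \<oplus> y \<otimes> t) \<otimes> u"
    using y by algebra
  then show ?case using y by (simp add: pCons int_embed_0)
qed (use y in simp)

lemma ring_eval_minus [simp]:
  assumes y: "y \<in> carrier R"
  shows "ring_eval R y (- f) = \<ominus> ring_eval R y f"
proof -
  have "ring_eval R y (- f) = [(-1::int)] \<cdot> \<one> \<otimes> ring_eval R y f"
    using ring_eval_smult[OF y, of "-1" f] by simp
  also have "\<dots> = \<ominus> ring_eval R y f"
    using y int_embed_minus[of 1] by (simp add: int_embed_1 l_minus)
  finally show ?thesis .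
qed

lemma ring_eval_diff [simp]:
  "y \<in> carrier R \<Longrightarrow> ring_eval R y (f - g) = ring_eval R y f \<ominus> ring_eval R y g"
  using ring_eval_add[of y f "- g"] by (simp add: minus_eq)

lemma ring_eval_monom [simp]:
  assumes y: "y \<in> carrier R"
  shows "ring_eval R y (Polynomial.monom a n) = [a] \<cdot> \<one> \<otimes> y [^] n"
proof (induction n)
  case 0
  then show ?case using y by (simp add: monom_0)
next
  case (Suc n)
  then show ?case using y by (simp add: monom_Suc int_embed_0 m_ac)
qed

lemma ring_eval_sum:
  assumes y: "y \<in> carrier R"
  shows "finite A \<Longrightarrow> ring_eval R y (\<Sum>i\<in>A. h i) = (\<Oplus>i\<in>A. ring_eval R y (h i))"
  by (induction A rule: finite_induct) (use y in simp_all)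

end

text \<open>Isolates what the computations at one prime take from the algebraic closure, so that
  they mention neither closures nor the product over all primes.\<close>

locale cyclotomic_residue_field = field R for R :: "'a ring" (structure) +
  fixes N p :: nat and y :: 'a
  assumes N_pos: "N \<ge> 1"
    and p_prime: "Factorial_Ring.prime p"
    and int_embed_eq_0_iff: "[(k::int)] \<cdot> \<one> = \<zero> \<longleftrightarrow> int p dvd k"
    and y_primitive: "primitive_root R N y"
begin

lemma y_closed [simp, intro]: "y \<in> carrier R"
  and y_pow_N: "y [^] N = \<one>"
  and y_pow_neq_1: "0 < m \<Longrightarrow> m < N \<Longrightarrow> y [^] m \<noteq> \<one>"
  using y_primitive by (simp_all add: primitive_root_def)

text \<open>As \<open>y [^] N\<close> is 1, reduction modulo X^N - 1 shows that sums of
  \<open>N\<close> terms already exhaust the image of all integral polynomials. Written as such an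
  image, the set is visibly closed under products.\<close>

lemma carrier_Fp_adjoin: "carrier (Fp_adjoin N R y) = range (ring_eval R y)"
proof
  have "(\<Oplus>j\<in>{..<N}. ([c j] \<cdot> \<one>) \<otimes> (y [^] j)) = ring_eval R y (\<Sum>j<N. Polynomial.monom (c j) j)"
    for c :: "nat \<Rightarrow> int" by (simp add: ring_eval_sum)
  then show "carrier (Fp_adjoin N R y) \<subseteq> range (ring_eval R y)"
    by (auto simp: Fp_adjoin_def)
next
  have "\<exists>c :: nat \<Rightarrow> int. ring_eval R y f = ring_eval R y (\<Sum>j<N. Polynomial.monom (c j) j)" for f
  proof -
    obtain q r where f: "f = (Polynomial.monom 1 N - 1) * q + r" and r: "Polynomial.degree r < N"
      using division_by_monom_diff_1[OF N_pos] .
    have "r = (\<Sum>j<N. Polynomial.monom (Polynomial.coeff r j) j)"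
      using poly_as_sum_of_monoms'[of r "N - 1"] r N_pos lessThan_Suc_atMost[of "N - 1"] by simp
    moreover have "ring_eval R y f = ring_eval R y r"
      unfolding f by (simp add: y_pow_N int_embed_1 minus_eq r_neg)
    ultimately show ?thesis by metis
  qed
  then show "range (ring_eval R y) \<subseteq> carrier (Fp_adjoin N R y)"
    by (auto simp: Fp_adjoin_def ring_eval_sum)
qed

lemma Fp_adjoin_simps [simp]:
  "\<zero>\<^bsub>Fp_adjoin N R y\<^esub> = \<zero>" "\<one>\<^bsub>Fp_adjoin N R y\<^esub> = \<one>"
  "a \<oplus>\<^bsub>Fp_adjoin N R y\<^esub> b = a \<oplus> b" "a \<otimes>\<^bsub>Fp_adjoin N R y\<^esub> b = a \<otimes> b"
  by (simp_all add: Fp_adjoin_def)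

lemma subcring_Fp_adjoin: "subcring (carrier (Fp_adjoin N R y)) R"
  unfolding carrier_Fp_adjoin
proof (rule subcringI)
  show "subring (range (ring_eval R y)) R"
  proof (rule subringI)
    show "range (ring_eval R y) \<subseteq> carrier R" by auto
    show "\<one> \<in> range (ring_eval R y)"
      using ring_eval_1[OF y_closed] by (intro image_eqI[of _ _ 1]) simp_all
    fix h assume "h \<in> range (ring_eval R y)"
    then obtain f where f: "h = ring_eval R y f" by blast
    show "\<ominus> h \<in> range (ring_eval R y)"
      using f by (intro image_eqI[of _ _ "- f"]) simp_all
    fix k assume "k \<in> range (ring_eval R y)"
    then obtain g where g: "k = ring_eval R y g" by blast
    show "h \<otimes> k \<in> range (ring_eval R y)"
      using f g by (intro image_eqI[of _ _ "f * g"]) simp_all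
    show "h \<oplus> k \<in> range (ring_eval R y)"
      using f g by (intro image_eqI[of _ _ "f + g"]) simp_all
  qed
  show "h \<otimes> k = k \<otimes> h" if "h \<in> range (ring_eval R y)" "k \<in> range (ring_eval R y)" for h k
    using that by (auto intro: m_comm)
qed

lemma cring_Fp_adjoin: "cring (Fp_adjoin N R y)"
proof -
  have "Fp_adjoin N R y = R\<lparr>carrier := carrier (Fp_adjoin N R y)\<rparr>"
    by (simp add: Fp_adjoin_def)
  moreover have "cring (R\<lparr>carrier := carrier (Fp_adjoin N R y)\<rparr>)"
    using subcring_iff[OF subcringE(1)[OF subcring_Fp_adjoin]] subcring_Fp_adjoin by blast
  ultimately show ?thesis by (rule back_subst[of cring, OF _ sym, rotated])
qed

lemmas Fp_adjoin_subcringE = subcringE[OF subcring_Fp_adjoin]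

lemma int_embed_in_Fp_adjoin: "[(k::int)] \<cdot> \<one> \<in> carrier (Fp_adjoin N R y)"
proof -
  have "ring_eval R y [:k:] = [k] \<cdot> \<one>" by simp
  then show ?thesis unfolding carrier_Fp_adjoin by (metis rangeI)
qed

lemma pow_in_Fp_adjoin:
  "a \<in> carrier (Fp_adjoin N R y) \<Longrightarrow> a [^] (n::nat) \<in> carrier (Fp_adjoin N R y)"
  by (induction n) (auto intro: Fp_adjoin_subcringE)

lemma y_in_Fp_adjoin: "y \<in> carrier (Fp_adjoin N R y)"
proof -
  have "ring_eval R y [:0, 1:] = y" using int_embed_1 by (simp add: int_embed_0)
  then show ?thesis unfolding carrier_Fp_adjoin by (metis rangeI)
qed

text \<open>The inverse is taken in the large field; an integer inverse of \<open>k\<close> modulo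
  \<open>p\<close> shows that it already lies in the prime field.\<close>

lemma inv_int_embed_in_Fp_adjoin:
  assumes "\<not> int p dvd k"
  shows "inv ([k] \<cdot> \<one>) \<in> carrier (Fp_adjoin N R y)"
proof -
  have "coprime k (int p)"
    using assms p_prime by (metis coprime_commute prime_imp_coprime prime_int_nat_transfer int_int_eq of_nat_0_le_iff nat_int)
  then obtain m where m: "[k * m = 1] (mod (int p))" by (metis coprime_iff_invertible_int)
  then obtain l where "k * m + (- l) * int p = 1"
    by (metis cong_iff_lin cong_sym add_diff_cancel_right' diff_conv_add_uminus mult_minus_left mult.commute)
  then have "[(k * m + (- l) * int p)] \<cdot> \<one> = \<one>" by (simp add: int_embed_1)
  then have "[k] \<cdot> \<one> \<otimes> [m] \<cdot> \<one> = \<one>"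
    using int_embed_eq_0_iff[of "int p"] unfolding int_embed_add int_embed_mult by simp
  then have "inv ([k] \<cdot> \<one>) = [m] \<cdot> \<one>" by (intro comm_inv_char) simp_all
  then show ?thesis by (simp add: int_embed_in_Fp_adjoin)
qed

lemma int_embed_Unit: "\<not> int p dvd k \<Longrightarrow> [k] \<cdot> \<one> \<in> Units R"
  by (simp add: field_Units int_embed_eq_0_iff)

text \<open>Each X^d - 1 with 0 < d < N is nonzero at \<open>y\<close>, because \<open>y\<close> has
  exact order \<open>N\<close>; in a field their product is nonzero too and can be
  cancelled.\<close>

lemma ring_eval_eq_0:
  assumes xi: "primitive_root complex_ring N xi" and f: "int_eval f xi = 0"
  shows "ring_eval R y f = \<zero>"
proof -
  have "(Polynomial.monom 1 N - 1) dvd f * (\<Prod>d\<in>{1..<N}. Polynomial.monom 1 d - 1)"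
    by (rule dvd_vanishing_int_poly[OF N_pos xi f])
  then obtain g where g: "f * (\<Prod>d\<in>{1..<N}. Polynomial.monom 1 d - 1) = (Polynomial.monom 1 N - 1) * g"
    by blast
  have "ring_eval R y f \<otimes> ring_eval R y (\<Prod>d\<in>{1..<N}. Polynomial.monom 1 d - 1) = \<zero>"
    using arg_cong[OF g, of "ring_eval R y"] by (simp add: int_embed_1 y_pow_N minus_eq r_neg)
  moreover have "ring_eval R y (\<Prod>d\<in>A. Polynomial.monom 1 d - 1) \<noteq> \<zero>" if "finite A" "A \<subseteq> {1..<N}" for A
    using that
  proof (induction A rule: finite_induct)
    case (insert d A)
    have "y [^] d \<ominus> \<one> \<noteq> \<zero>" using y_pow_neq_1[of d] insert.prems by auto
    then show ?case using insert by (simp add: int_embed_1 integral_iff)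
  qed simp
  ultimately show ?thesis by (meson finite_atLeastLessThan integral ring_eval_closed subset_refl y_closed)
qed

lemma rat_red_in_Fp_adjoin: "rat_red p R a \<in> carrier (Fp_adjoin N R y)"
  unfolding rat_red_def by (auto split: prod.split intro!: Fp_adjoin_subcringE(2,6)
      int_embed_in_Fp_adjoin inv_int_embed_in_Fp_adjoin)

text \<open>The reduced denominator of \<open>a\<close> divides every \<open>M\<close> that makes
  \<open>M a\<close> integral. So if \<open>p\<close> does not divide \<open>M\<close>, the default
  value zero of \<open>rat_red\<close> does not occur.\<close>

lemma int_embed_mult_rat_red:
  assumes M: "of_int M * a = of_int n" "\<not> int p dvd M"
  shows "[M] \<cdot> \<one> \<otimes> rat_red p R a = [n] \<cdot> \<one>"
proof -
  obtain b d where q: "quotient_of a = (b, d)" by fastforce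
  have d: "d > 0" using quotient_of_denom_pos[OF q] .
  have a: "a = of_int b / of_int d" using quotient_of_div[OF q] .
  have "of_int (M * b) = (of_int (n * d) :: rat)" using M(1) d unfolding a by (simp add: field_simps)
  then have eq: "M * b = n * d" by (metis of_int_eq_iff)
  have "coprime b d" using quotient_of_coprime[OF q] .
  then have "d dvd M" using eq by (metis coprime_commute coprime_dvd_mult_left_iff dvd_triv_right)
  then have nd: "\<not> int p dvd d" using M(2) dvd_trans by blast
  have "[M] \<cdot> \<one> \<otimes> rat_red p R a = [(M * b)] \<cdot> \<one> \<otimes> inv ([d] \<cdot> \<one>)"
    using nd int_embed_Unit[OF nd] by (simp add: rat_red_def q int_embed_mult m_assoc)
  also have "\<dots> = [n] \<cdot> \<one>"
    using int_embed_Unit[OF nd] by (simp add: eq int_embed_mult m_assoc)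
  finally show ?thesis .
qed

end

section \<open>The stuffle relation at a single prime\<close>

lemma Gamma_eq_powers:
  assumes N: "N \<ge> 1" and xi: "primitive_root complex_ring N xi"
  shows "Gamma N = (\<lambda>e. xi ^ e) ` {..<N}"
proof -
  have xi': "xi ^ N = 1" "\<And>m. 0 < m \<Longrightarrow> m < N \<Longrightarrow> xi ^ m \<noteq> 1"
    using xi by (simp_all add: primitive_root_complex_ring_iff)
  have sub: "(\<lambda>e. xi ^ e) ` {..<N} \<subseteq> Gamma N"
    by (auto simp: Gamma_def) (metis power_mult mult.commute power_one xi'(1))
  have fin: "finite (Gamma N)" unfolding Gamma_def using N by (intro finite_roots_unity) auto
  have "card (Gamma N) \<le> card ((\<lambda>e. xi ^ e) ` {..<N})"
    using card_roots_unity[of N, where 'a = complex] N inj_on_root_powers[OF xi']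
    by (simp add: Gamma_def card_image)
  then show ?thesis using card_seteq[OF fin sub] by simp
qed

lemma Gamma_mult: "mu \<in> Gamma N \<Longrightarrow> nu \<in> Gamma N \<Longrightarrow> mu * nu \<in> Gamma N"
  by (simp add: Gamma_def power_mult_distrib)

lemma root_power_mod:
  fixes xi :: complex
  assumes "xi ^ N = 1"
  shows "xi ^ (e mod N) = xi ^ e"
proof -
  have "xi ^ e = xi ^ (N * (e div N) + e mod N)" by simp
  also have "\<dots> = xi ^ (e mod N)" unfolding power_add power_mult assms by simp
  finally show ?thesis by simp
qed

section \<open>Decreasing tuples and stuffles with multiplicities\<close>

lemma finite_decreasing_tuples [simp]: "finite (decreasing_tuples n d)"
proof (rule finite_subset)
  show "decreasing_tuples n d \<subseteq> {ks. set ks \<subseteq> {..<n} \<and> length ks = d}"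
    by (auto simp: decreasing_tuples_def)
qed (simp add: finite_lists_length_eq)

lemma decreasing_tuples_0_right [simp]: "decreasing_tuples n 0 = {[]}"
  by (auto simp: decreasing_tuples_def)

lemma decreasing_tuples_0_left [simp]: "decreasing_tuples 0 (Suc d) = {}"
  by (auto simp: decreasing_tuples_def length_Suc_conv)

text \<open>Either all entries are below \<open>n\<close>, or the first one is \<open>n\<close>. The
  second case is absent for \<open>n = 0\<close>, since entries are positive.\<close>

lemma decreasing_tuples_Suc:
  "decreasing_tuples (Suc n) (Suc d) =
    decreasing_tuples n (Suc d) \<union> (if n = 0 then {} else (#) n ` decreasing_tuples n d)"
proof (rule Set.set_eqI)
  fix ks
  show "ks \<in> decreasing_tuples (Suc n) (Suc d) \<longleftrightarrow>
    ks \<in> decreasing_tuples n (Suc d) \<union> (if n = 0 then {} else (#) n ` decreasing_tuples n d)"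
  proof (cases ks)
    case (Cons k l)
    then show ?thesis by (cases "k = n") (force simp: decreasing_tuples_def image_iff)+
  qed (auto simp: decreasing_tuples_def)
qed

text \<open>The coefficients of a stuffle product of words are multiplicities. A list records them
  without complex coefficients, so the product can be summed in the fields \<open>L p\<close> as
  well as in \<open>A(N)\<close>.\<close>

fun stuffle_list :: "word \<Rightarrow> word \<Rightarrow> word list" where
  "stuffle_list [] w = [w]"
| "stuffle_list w [] = [w]"
| "stuffle_list ((m, mu) # u) ((n, nu) # v) =
     map ((#) (m, mu)) (stuffle_list u ((n, nu) # v))
   @ map ((#) (n, nu)) (stuffle_list ((m, mu) # u) v)
   @ map ((#) (m + n, mu * nu)) (stuffle_list u v)"

lemma stuffle_list_Nil_right [simp]: "stuffle_list w [] = [w]"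
  by (cases w) auto

lemma stuffle_list_in_letters:
  assumes "u \<in> lists (letters N)" "v \<in> lists (letters N)" "w \<in> set (stuffle_list u v)"
  shows "w \<in> lists (letters N)"
  using assms
proof (induction u v arbitrary: w rule: stuffle_list.induct)
  case (3 m mu u n nu v)
  have mem: "(m, mu) \<in> letters N" "(n, nu) \<in> letters N" "u \<in> lists (letters N)" "v \<in> lists (letters N)"
    using "3.prems" by (auto elim: listsE)
  have mn: "(m + n, mu * nu) \<in> letters N" using mem by (simp add: letters_def Gamma_mult)
  consider w' where "w = (m, mu) # w'" "w' \<in> set (stuffle_list u ((n, nu) # v))"
    | w' where "w = (n, nu) # w'" "w' \<in> set (stuffle_list ((m, mu) # u) v)"
    | w' where "w = (m + n, mu * nu) # w'" "w' \<in> set (stuffle_list u v)"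
    using "3.prems"(3) by auto
  then show ?case
  proof cases
    case 1
    have "w' \<in> lists (letters N)" using "3.IH"(1)[OF mem(3) "3.prems"(2)] 1(2) by blast
    then show ?thesis using 1(1) mem(1) by simp
  next
    case 2
    have "w' \<in> lists (letters N)" using "3.IH"(2)[OF "3.prems"(1) mem(4)] 2(2) by blast
    then show ?thesis using 2(1) mem(2) by simp
  next
    case 3
    have "w' \<in> lists (letters N)" using "3.IH"(3)[OF mem(3,4)] 3(2) by blast
    then show ?thesis using 3(1) mn by simp
  qed
qed simp_all

text \<open>A sum over a list rather than \<open>finsum\<close> over a set, so that words occurring
  several times are counted as often.\<close>

definition list_sum :: "('a, 'b) ring_scheme \<Rightarrow> ('i \<Rightarrow> 'a) \<Rightarrow> 'i list \<Rightarrow> 'a" where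
  "list_sum R f ws = foldr (\<lambda>w r. f w \<oplus>\<^bsub>R\<^esub> r) ws \<zero>\<^bsub>R\<^esub>"

context abelian_monoid begin

lemma list_sum_Nil [simp]: "list_sum G f [] = \<zero>"
  and list_sum_Cons [simp]: "list_sum G f (w # ws) = f w \<oplus> list_sum G f ws"
  by (simp_all add: list_sum_def)

lemma list_sum_closed [simp, intro]: "(\<And>w. w \<in> set ws \<Longrightarrow> f w \<in> carrier G) \<Longrightarrow> list_sum G f ws \<in> carrier G"
  by (induction ws) auto

lemma list_sum_append:
  assumes "\<And>w. w \<in> set ws \<union> set vs \<Longrightarrow> f w \<in> carrier G"
  shows "list_sum G f (ws @ vs) = list_sum G f ws \<oplus> list_sum G f vs"
  using assms by (induction ws) (simp_all add: a_assoc)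

end

context cring begin

lemma list_sum_add_mult:
  assumes "\<And>w. w \<in> set ws \<Longrightarrow> f w \<in> carrier R" "\<And>w. w \<in> set ws \<Longrightarrow> g w \<in> carrier R" "t \<in> carrier R"
  shows "list_sum R (\<lambda>w. f w \<oplus> t \<otimes> g w) ws = list_sum R f ws \<oplus> t \<otimes> list_sum R g ws"
  using assms(1,2)
proof (induction ws)
  case (Cons w ws)
  have "\<And>a b c d. a \<in> carrier R \<Longrightarrow> b \<in> carrier R \<Longrightarrow> c \<in> carrier R \<Longrightarrow> d \<in> carrier R \<Longrightarrow>
      (a \<oplus> t \<otimes> b) \<oplus> (c \<oplus> t \<otimes> d) = (a \<oplus> c) \<oplus> t \<otimes> (b \<oplus> d)"
    using assms(3) by algebra
  then show ?case using Cons by simp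
qed (use assms(3) in simp)

lemma finprod_lessThan_Suc_shift:
  assumes "\<And>i. i \<le> n \<Longrightarrow> f i \<in> carrier R"
  shows "(\<Otimes>i\<in>{..<Suc n}. f i) = f 0 \<otimes> (\<Otimes>i\<in>{..<n}. f (Suc i))"
proof -
  have "(\<Otimes>i\<in>{..<Suc n}. f i) = f 0 \<otimes> (\<Otimes>i\<in>Suc ` {..<n}. f i)"
    unfolding lessThan_Suc_eq_insert_0 using assms by (intro finprod_insert) auto
  also have "(\<Otimes>i\<in>Suc ` {..<n}. f i) = (\<Otimes>i\<in>{..<n}. f (Suc i))"
    using assms by (intro finprod_reindex) auto
  finally show ?thesis .
qed

end

section \<open>Truncated sums of a word at one prime\<close>

context cyclotomic_residue_field begin

lemma root_red_in_Fp_adjoin: "root_red N xi R y eta \<in> carrier (Fp_adjoin N R y)"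
  unfolding root_red_def by (intro pow_in_Fp_adjoin y_in_Fp_adjoin)

lemma Fp_adjoin_in_carrier: "a \<in> carrier (Fp_adjoin N R y) \<Longrightarrow> a \<in> carrier R"
  using Fp_adjoin_subcringE(1) by blast

lemma root_red_closed [simp, intro]: "root_red N xi R y eta \<in> carrier R"
  by (intro Fp_adjoin_in_carrier root_red_in_Fp_adjoin)

text \<open>\<open>root_red\<close> picks the exponent below \<open>N\<close>, here
  \<open>e mod N\<close>. The order of \<open>y\<close> makes the choice of exponent immaterial,
  which yields multiplicativity on \<open>Gamma N\<close>.\<close>

lemma root_red_power:
  assumes xi: "primitive_root complex_ring N xi"
  shows "root_red N xi R y (xi ^ e) = y [^] e"
proof -
  have xi': "xi ^ N = 1" "\<And>m. 0 < m \<Longrightarrow> m < N \<Longrightarrow> xi ^ m \<noteq> 1"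
    using xi by (simp_all add: primitive_root_complex_ring_iff)
  have "(THE e'. e' < N \<and> xi ^ e = xi ^ e') = e mod N"
  proof (rule the_equality)
    show e: "e mod N < N \<and> xi ^ e = xi ^ (e mod N)"
      using N_pos root_power_mod[OF xi'(1)] by simp
    fix e' assume e': "e' < N \<and> xi ^ e = xi ^ e'"
    show "e' = e mod N"
      using inj_onD[OF inj_on_root_powers[OF xi'], of e' "e mod N"] e e' by simp
  qed
  then have "root_red N xi R y (xi ^ e) = y [^] (e mod N)" by (simp add: root_red_def)
  moreover have "y [^] (N * (e div N) + e mod N) = (y [^] N) [^] (e div N) \<otimes> y [^] (e mod N)"
    by (simp only: nat_pow_pow[OF y_closed] nat_pow_mult[OF y_closed])
  ultimately show ?thesis by (simp add: y_pow_N)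
qed

lemma root_red_mult:
  assumes xi: "primitive_root complex_ring N xi" and "mu \<in> Gamma N" "nu \<in> Gamma N"
  shows "root_red N xi R y (mu * nu) = root_red N xi R y mu \<otimes> root_red N xi R y nu"
proof -
  obtain d e where "mu = xi ^ d" "nu = xi ^ e"
    using assms(2,3) Gamma_eq_powers[OF N_pos xi] by auto
  then show ?thesis using xi by (simp add: root_red_power nat_pow_mult flip: power_add)
qed

lemma nat_embed_Unit: "0 < k \<Longrightarrow> k < p \<Longrightarrow> [k] \<cdot> \<one> \<in> Units R"
  using int_embed_Unit[of "int k"] by (simp add: int_embed_nat nat_dvd_not_less)

definition colored_term :: "complex \<Rightarrow> word \<Rightarrow> nat list \<Rightarrow> 'a" where
  "colored_term xi w ks =
     (\<Otimes>i\<in>{..<length w}. root_red N xi R y (snd (w ! i)) [^] (ks ! i)) \<otimes>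
     inv (\<Otimes>i\<in>{..<length w}. ([ks ! i] \<cdot> \<one>) [^] fst (w ! i))"

text \<open>\<open>fcmzv_component\<close> uses its prime only as the summation bound. Passing
  \<open>n\<close> instead truncates the sum while the field keeps characteristic
  \<open>p\<close>.\<close>

definition word_component :: "complex \<Rightarrow> nat \<Rightarrow> word \<Rightarrow> 'a" where
  "word_component xi n w = fcmzv_component N xi n R y (map fst w) (map snd w)"

lemma word_component_altdef:
  "word_component xi n w = (\<Oplus>ks\<in>decreasing_tuples n (length w). colored_term xi w ks)"
proof -
  have "(\<Otimes>i\<in>{..<length w}. root_red N xi R y (map snd w ! i) [^] (ks ! i)) =
      (\<Otimes>i\<in>{..<length w}. root_red N xi R y (snd (w ! i)) [^] (ks ! i))"
    "(\<Otimes>i\<in>{..<length w}. ([ks ! i] \<cdot> \<one>) [^] (map fst w ! i)) =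
      (\<Otimes>i\<in>{..<length w}. ([ks ! i] \<cdot> \<one>) [^] fst (w ! i))" for ks :: "nat list"
    by (rule finprod_cong'; auto)+
  then show ?thesis
    by (simp add: word_component_def fcmzv_component_def colored_term_def)
qed

text \<open>The summation index 0 does not occur, hence the value \<open>\<zero>\<close> there.\<close>

definition letter_term :: "complex \<Rightarrow> nat \<times> complex \<Rightarrow> nat \<Rightarrow> 'a" where
  "letter_term xi a k = (if k = 0 then \<zero> else root_red N xi R y (snd a) [^] k \<otimes> inv (([k] \<cdot> \<one>) [^] fst a))"

lemma inv_mult_Units:
  assumes "a \<in> Units R" "b \<in> Units R"
  shows "inv (a \<otimes> b) = inv a \<otimes> inv b"
proof (rule comm_inv_char)
  have "a \<otimes> b \<otimes> (inv a \<otimes> inv b) = (a \<otimes> inv a) \<otimes> (b \<otimes> inv b)"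
    using assms by (simp add: m_ac Units_closed)
  then show "a \<otimes> b \<otimes> (inv a \<otimes> inv b) = \<one>" using assms by simp
qed (use assms in \<open>auto simp: Units_closed\<close>)

lemma finprod_Units: "(\<And>i. i \<in> A \<Longrightarrow> f i \<in> Units R) \<Longrightarrow> (\<Otimes>i\<in>A. f i) \<in> Units R"
proof (induction A rule: infinite_finite_induct)
  case (insert i A)
  then have "(\<Otimes>i\<in>insert i A. f i) = f i \<otimes> (\<Otimes>i\<in>A. f i)"
    by (intro finprod_insert) (auto simp: Units_closed)
  then show ?case using insert by auto
qed auto

lemma Units_nat_pow: "a \<in> Units R \<Longrightarrow> a [^] (n::nat) \<in> Units R"
  by (induction n) auto

text \<open>All indices lie strictly between 0 and \<open>p\<close>, so every denominator is a unit
  and the inverse of the product splits.\<close>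

lemma colored_term_Cons:
  assumes k: "0 < k" "k < p" and ks: "length ks = length w" "\<And>k. k \<in> set ks \<Longrightarrow> 0 < k \<and> k < p"
  shows "colored_term xi (a # w) (k # ks) = letter_term xi a k \<otimes> colored_term xi w ks"
proof -
  define A where "A = (\<Otimes>i\<in>{..<length w}. root_red N xi R y (snd (w ! i)) [^] (ks ! i))"
  define B where "B = (\<Otimes>i\<in>{..<length w}. ([ks ! i] \<cdot> \<one>) [^] fst (w ! i))"
  have A: "A \<in> carrier R" unfolding A_def by (intro finprod_closed) auto
  have B: "B \<in> Units R" unfolding B_def
    using ks by (intro finprod_Units Units_nat_pow nat_embed_Unit) auto
  have U: "([k] \<cdot> \<one>) [^] fst a \<in> Units R"
    using k by (intro Units_nat_pow nat_embed_Unit)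
  have "(\<Otimes>i\<in>{..<length (a # w)}. root_red N xi R y (snd ((a # w) ! i)) [^] ((k # ks) ! i))
      = root_red N xi R y (snd a) [^] k \<otimes> A"
    unfolding A_def list.size(4) add_Suc_right add_0_right
    by (subst finprod_lessThan_Suc_shift) auto
  moreover have "(\<Otimes>i\<in>{..<length (a # w)}. ([(k # ks) ! i] \<cdot> \<one>) [^] fst ((a # w) ! i))
      = ([k] \<cdot> \<one>) [^] fst a \<otimes> B"
    unfolding B_def list.size(4) add_Suc_right add_0_right
    by (subst finprod_lessThan_Suc_shift) auto
  ultimately have "colored_term xi (a # w) (k # ks) =
      (root_red N xi R y (snd a) [^] k \<otimes> A) \<otimes> (inv (([k] \<cdot> \<one>) [^] fst a) \<otimes> inv B)"
    using inv_mult_Units[OF U B] by (simp add: colored_term_def)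
  also have "\<dots> = letter_term xi a k \<otimes> (A \<otimes> inv B)"
    using A B U k by (simp add: letter_term_def m_ac)
  finally show ?thesis by (simp add: colored_term_def A_def B_def)
qed

lemma letter_term_in_Fp_adjoin: "k < p \<Longrightarrow> letter_term xi a k \<in> carrier (Fp_adjoin N R y)"
proof -
  assume k: "k < p"
  show ?thesis
  proof (cases "k = 0")
    case False
    have nd: "\<not> int p dvd int k ^ fst a"
      using False k p_prime
      by (metis of_nat_power int_dvd_int_iff prime_dvd_power_nat nat_dvd_not_less neq0_conv)
    have "([k] \<cdot> \<one>) [^] fst a = [(int k ^ fst a)] \<cdot> \<one>"
      by (simp add: int_embed_power int_embed_nat)
    then show ?thesis using False inv_int_embed_in_Fp_adjoin[OF nd]
      by (auto simp: letter_term_def intro!: Fp_adjoin_subcringE(6) pow_in_Fp_adjoin root_red_in_Fp_adjoin)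
  qed (simp add: letter_term_def Fp_adjoin_subcringE)
qed

lemma letter_term_closed: "k < p \<Longrightarrow> letter_term xi a k \<in> carrier R"
  by (intro Fp_adjoin_in_carrier letter_term_in_Fp_adjoin)

text \<open>The source of the third stuffle term: two letters meeting at the same index
  \<open>k\<close> merge into one.\<close>

lemma letter_term_mult:
  assumes xi: "primitive_root complex_ring N xi" and k: "k < p"
    and "mu \<in> Gamma N" "nu \<in> Gamma N"
  shows "letter_term xi (m, mu) k \<otimes> letter_term xi (n, nu) k = letter_term xi (m + n, mu * nu) k"
proof (cases "k = 0")
  case False
  let ?K = "[k] \<cdot> \<one>" and ?r = "root_red N xi R y"
  have K: "?K [^] m \<in> Units R" "?K [^] n \<in> Units R"
    using False k by (auto intro!: Units_nat_pow nat_embed_Unit)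
  have "letter_term xi (m + n, mu * nu) k = (?r mu \<otimes> ?r nu) [^] k \<otimes> inv (?K [^] m \<otimes> ?K [^] n)"
    using False assms by (simp add: letter_term_def root_red_mult nat_pow_mult)
  also have "\<dots> = (?r mu [^] k \<otimes> ?r nu [^] k) \<otimes> (inv (?K [^] m) \<otimes> inv (?K [^] n))"
    using K by (simp add: inv_mult_Units nat_pow_distrib)
  also have "\<dots> = letter_term xi (m, mu) k \<otimes> letter_term xi (n, nu) k"
    using False K by (simp add: letter_term_def m_ac)
  finally show ?thesis by simp
qed (simp add: letter_term_def)

lemma colored_term_Nil [simp]: "colored_term xi [] ks = \<one>"
  by (simp add: colored_term_def)

lemma word_component_Nil [simp]: "word_component xi n [] = \<one>"
  by (simp add: word_component_altdef)

lemma colored_term_closed: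
  assumes "ks \<in> decreasing_tuples n (length w)" "n \<le> p"
  shows "colored_term xi w ks \<in> carrier R"
proof -
  have "0 < ks ! i" "ks ! i < p" if "i < length w" for i
  proof -
    have "ks ! i \<in> set ks" "\<And>k. k \<in> set ks \<Longrightarrow> 0 < k \<and> k < n"
      using assms(1) that by (auto simp: decreasing_tuples_def)
    then show "0 < ks ! i" "ks ! i < p" using assms(2) by fastforce+
  qed
  then show ?thesis unfolding colored_term_def
    by (intro m_closed Units_closed[OF Units_inv_Units] finprod_Units finprod_closed Units_nat_pow nat_embed_Unit) auto
qed

lemma word_component_0: "word_component xi 0 (a # w) = \<zero>"
  by (simp add: word_component_altdef)

text \<open>At \<open>n = 0\<close> no tuple is added, and \<open>letter_term\<close> vanishes
  there, so the recursion needs no exception.\<close>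

lemma word_component_Suc:
  assumes n: "n < p"
  shows "word_component xi (Suc n) (a # w) = word_component xi n (a # w) \<oplus> letter_term xi a n \<otimes> word_component xi n w"
proof -
  let ?T = "decreasing_tuples n (Suc (length w))"
  let ?U = "if n = 0 then {} else (#) n ` decreasing_tuples n (length w)"
  have cl: "colored_term xi (a # w) ks \<in> carrier R" if "ks \<in> ?T \<union> ?U" for ks
    using that n colored_term_closed[of ks "Suc n" "a # w" xi] by (simp add: decreasing_tuples_Suc)
  have "word_component xi (Suc n) (a # w) = (\<Oplus>ks\<in>?T \<union> ?U. colored_term xi (a # w) ks)"
    by (simp add: word_component_altdef decreasing_tuples_Suc)
  also have "\<dots> = (\<Oplus>ks\<in>?T. colored_term xi (a # w) ks) \<oplus> (\<Oplus>ks\<in>?U. colored_term xi (a # w) ks)"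
  proof (rule finsum_Un_disjoint)
    show "?T \<inter> ?U = {}" by (auto simp: decreasing_tuples_def)
  qed (use cl in auto)
  also have "(\<Oplus>ks\<in>?U. colored_term xi (a # w) ks) = letter_term xi a n \<otimes> word_component xi n w"
  proof (cases "n = 0")
    case False
    then have "(\<Oplus>ks\<in>?U. colored_term xi (a # w) ks) =
        (\<Oplus>ks\<in>decreasing_tuples n (length w). colored_term xi (a # w) (n # ks))"
      using cl by (simp, intro finsum_reindex) auto
    also have "\<dots> = (\<Oplus>ks\<in>decreasing_tuples n (length w). letter_term xi a n \<otimes> colored_term xi w ks)"
      using False n colored_term_closed[of _ n w xi]
      by (intro finsum_cong') (auto simp: letter_term_closed decreasing_tuples_def intro!: colored_term_Cons)
    also have "\<dots> = letter_term xi a n \<otimes> word_component xi n w"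
      unfolding word_component_altdef using n colored_term_closed[of _ n w xi]
      by (intro finsum_rdistr[symmetric]) (auto simp: letter_term_closed)
    finally show ?thesis .
  next
    case True
    then show ?thesis using colored_term_closed[of _ 0 w xi]
      by (auto simp: letter_term_def word_component_altdef intro!: l_null[symmetric] finsum_closed)
  qed
  finally show ?thesis by (simp add: word_component_altdef)
qed

text \<open>The summands contain inverses taken in the large field; the recursion reduces membership
  in the subring to single letters.\<close>

lemma word_component_in_Fp_adjoin: "n \<le> p \<Longrightarrow> word_component xi n w \<in> carrier (Fp_adjoin N R y)"
proof (induction n arbitrary: w)
  case 0
  then show ?case by (cases w) (auto simp: word_component_0 Fp_adjoin_subcringE)
next
  case (Suc n)
  then show ?case by (cases w)
    (auto simp: word_component_Suc intro!: Fp_adjoin_subcringE(3,6,7) letter_term_in_Fp_adjoin)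
qed

lemma word_component_closed: "n \<le> p \<Longrightarrow> word_component xi n w \<in> carrier R"
  by (intro Fp_adjoin_in_carrier word_component_in_Fp_adjoin)

lemma list_sum_word_component_Suc:
  assumes n: "n < p"
  shows "list_sum R (word_component xi (Suc n)) (map ((#) a) ws) =
    list_sum R (word_component xi n) (map ((#) a) ws) \<oplus> letter_term xi a n \<otimes> list_sum R (word_component xi n) ws"
proof -
  have map: "list_sum R f (map ((#) a) ws) = list_sum R (\<lambda>w. f (a # w)) ws" for f :: "word \<Rightarrow> 'a"
    by (induction ws) auto
  show ?thesis unfolding map word_component_Suc[OF n]
    using n by (intro list_sum_add_mult) (auto simp: word_component_closed letter_term_closed)
qed

lemma word_component_stuffle:
  assumes xi: "primitive_root complex_ring N xi"
  shows "n \<le> p \<Longrightarrow> u \<in> lists (letters N) \<Longrightarrow> v \<in> lists (letters N) \<Longrightarrow>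
    word_component xi n u \<otimes> word_component xi n v = list_sum R (word_component xi n) (stuffle_list u v)"
proof (induction n arbitrary: u v)
  case 0
  \<comment> \<open>Stuffling two nonempty words yields only nonempty words, and their sums are
    empty at bound 0.\<close>
  have "list_sum R (word_component xi 0) (map ((#) a) ws) = \<zero>" for a ws
    by (induction ws) (auto simp: word_component_0)
  then show ?case
    by (cases "(u, v)" rule: stuffle_list.cases)
      (simp_all add: word_component_0 list_sum_append word_component_closed)
next
  case (Suc n)
  have n: "n < p" using Suc.prems by simp
  show ?case
  proof (cases "(u, v)" rule: stuffle_list.cases)
    case (3 s mu u' t nu v')
    let ?a = "(s, mu)" and ?b = "(t, nu)" and ?c = "(s + t, mu * nu)"
    let ?w = "word_component xi n" and ?l = "\<lambda>a. letter_term xi a n"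
    let ?S = "list_sum R (word_component xi n)"
    have uv: "u = ?a # u'" "v = ?b # v'" using 3 by auto
    have mem: "u' \<in> lists (letters N)" "v' \<in> lists (letters N)" "mu \<in> Gamma N" "nu \<in> Gamma N"
      using Suc.prems by (auto simp: uv letters_def)
    have cl: "?w w \<in> carrier R" "?l a \<in> carrier R" "?S ws \<in> carrier R" for w a ws
      using n by (auto simp: word_component_closed letter_term_closed)
    have cl': "word_component xi (Suc n) w \<in> carrier R" for w
      using n by (auto simp: word_component_closed)
    \<comment> \<open>Expanding the product needs the relation at bound \<open>n\<close> for all
      four pairs formed from \<open>u\<close> or its tail and \<open>v\<close> or its tail; hence
      both words vary in the induction.\<close>
    have IH: "?w u' \<otimes> ?w v = ?S (stuffle_list u' v)" "?w u \<otimes> ?w v' = ?S (stuffle_list u v')"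
      "?w u' \<otimes> ?w v' = ?S (stuffle_list u' v')" "?w u \<otimes> ?w v = ?S (stuffle_list u v)"
      using Suc.IH Suc.prems mem by auto
    have split: "?S (stuffle_list u v) = ?S (map ((#) ?a) (stuffle_list u' v)) \<oplus>
        (?S (map ((#) ?b) (stuffle_list u v')) \<oplus> ?S (map ((#) ?c) (stuffle_list u' v')))"
      using cl by (simp add: uv list_sum_append)
    have "word_component xi (Suc n) u \<otimes> word_component xi (Suc n) v =
        (?w u \<oplus> ?l ?a \<otimes> ?w u') \<otimes> (?w v \<oplus> ?l ?b \<otimes> ?w v')"
      by (simp add: uv word_component_Suc[OF n])
    also have "\<dots> = ?w u \<otimes> ?w v \<oplus> (?l ?a \<otimes> (?w u' \<otimes> ?w v) \<oplus> (?l ?b \<otimes> (?w u \<otimes> ?w v') \<oplus>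
        (?l ?a \<otimes> ?l ?b) \<otimes> (?w u' \<otimes> ?w v')))"
    proof -
      have expand: "\<And>A B C D E F. A \<in> carrier R \<Longrightarrow> B \<in> carrier R \<Longrightarrow> C \<in> carrier R \<Longrightarrow> D \<in> carrier R \<Longrightarrow>
          E \<in> carrier R \<Longrightarrow> F \<in> carrier R \<Longrightarrow> (A \<oplus> B \<otimes> C) \<otimes> (D \<oplus> E \<otimes> F) =
          A \<otimes> D \<oplus> (B \<otimes> (C \<otimes> D) \<oplus> (E \<otimes> (A \<otimes> F) \<oplus> (B \<otimes> E) \<otimes> (C \<otimes> F)))"
        by algebra
      show ?thesis by (rule expand; rule cl)
    qed
    also have "?l ?a \<otimes> ?l ?b = ?l ?c"
      by (rule letter_term_mult[OF xi n mem(3,4)])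
    finally have "word_component xi (Suc n) u \<otimes> word_component xi (Suc n) v =
        (?S (map ((#) ?a) (stuffle_list u' v)) \<oplus>
        (?S (map ((#) ?b) (stuffle_list u v')) \<oplus> ?S (map ((#) ?c) (stuffle_list u' v')))) \<oplus>
        (?l ?a \<otimes> ?S (stuffle_list u' v) \<oplus> (?l ?b \<otimes> ?S (stuffle_list u v') \<oplus>
        ?l ?c \<otimes> ?S (stuffle_list u' v')))" unfolding IH split .
    also have "\<dots> = list_sum R (word_component xi (Suc n)) (stuffle_list u v)"
    proof -
      have "list_sum R (word_component xi (Suc n)) (stuffle_list u v) =
        (?S (map ((#) ?a) (stuffle_list u' v)) \<oplus> ?l ?a \<otimes> ?S (stuffle_list u' v)) \<oplus>
        ((?S (map ((#) ?b) (stuffle_list u v')) \<oplus> ?l ?b \<otimes> ?S (stuffle_list u v')) \<oplus>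
        (?S (map ((#) ?c) (stuffle_list u' v')) \<oplus> ?l ?c \<otimes> ?S (stuffle_list u' v')))"
        using cl' by (simp add: uv list_sum_append list_sum_word_component_Suc[OF n])
      moreover have "\<And>A B C D E F. A \<in> carrier R \<Longrightarrow> B \<in> carrier R \<Longrightarrow> C \<in> carrier R \<Longrightarrow> D \<in> carrier R \<Longrightarrow>
          E \<in> carrier R \<Longrightarrow> F \<in> carrier R \<Longrightarrow> (A \<oplus> (B \<oplus> C)) \<oplus> (D \<oplus> (E \<oplus> F)) =
          (A \<oplus> D) \<oplus> ((B \<oplus> E) \<oplus> (C \<oplus> F))"
        by algebra
      ultimately show ?thesis using cl by simp
    qed
    finally show ?thesis .
  qed (use Suc.prems in \<open>auto simp: word_component_closed\<close>)
qed

end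

text \<open>The embedding \<open>h\<close> of the prime field identifies the multiple
  \<open>k\<close> of 1 with \<open>h (k mod int p)\<close>. If \<open>p\<close> does not divide
  \<open>k\<close>, an integer inverse of \<open>k\<close> modulo \<open>p\<close> shows that this
  value is nonzero.\<close>

lemma cyclotomic_residue_fieldI:
  assumes "N \<ge> 1" "Factorial_Ring.prime p" "is_alg_closure_of (residue_ring (int p)) L" "primitive_root L N y"
  shows "cyclotomic_residue_field L N p y"
proof -
  interpret F: residues_prime p "residue_ring (int p)"
    by unfold_locales (use assms in auto)
  obtain h where h: "h \<in> ring_hom (residue_ring (int p)) L" and "algebraic_closure L (h ` carrier (residue_ring (int p)))"
    using assms(3) by (auto simp: is_alg_closure_of_def)
  then interpret L: field L by (simp add: algebraic_closure_def)
  have h0: "h 0 = \<zero>\<^bsub>L\<^esub>"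
    using ring_hom_zero[OF h F.ring_axioms L.ring_axioms] by (simp add: residue_ring_def)
  have h1: "h 1 = \<one>\<^bsub>L\<^esub>" using ring_hom_one[OF h] by (simp add: residue_ring_def)
  have p: "p > 1" using assms(2) prime_gt_1_nat by blast
  have h_add: "h ((a + b) mod int p) = h (a mod int p) \<oplus>\<^bsub>L\<^esub> h (b mod int p)"
    and h_mult: "h ((a * b) mod int p) = h (a mod int p) \<otimes>\<^bsub>L\<^esub> h (b mod int p)"
    and h_closed: "h (a mod int p) \<in> carrier L" for a b
    using ring_hom_add[OF h, of "a mod int p" "b mod int p"] ring_hom_mult[OF h, of "a mod int p" "b mod int p"]
      ring_hom_closed[OF h, of "a mod int p"] p
    by (simp_all add: residue_ring_def mod_simps)
  have nat: "[(int n)] \<cdot>\<^bsub>L\<^esub> \<one>\<^bsub>L\<^esub> = h (int n mod int p)" for n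
  proof (induction n)
    case (Suc n)
    have "h (int (Suc n) mod int p) = h (int n mod int p) \<oplus>\<^bsub>L\<^esub> h (1 mod int p)"
      using h_add[of "int n" 1] by (simp add: add.commute)
    also have "\<dots> = [(int (Suc n))] \<cdot>\<^bsub>L\<^esub> \<one>\<^bsub>L\<^esub>"
      using p h1 Suc L.int_embed_add[of "int n" 1] by (simp add: L.int_embed_1 add.commute)
    finally show ?case by simp
  qed (simp add: h0 L.int_embed_0)
  have emb: "[k] \<cdot>\<^bsub>L\<^esub> \<one>\<^bsub>L\<^esub> = h (k mod int p)" for k
  proof (cases "k \<ge> 0")
    case True
    then show ?thesis using nat[of "nat k"] by simp
  next
    case False
    have "[k] \<cdot>\<^bsub>L\<^esub> \<one>\<^bsub>L\<^esub> \<oplus>\<^bsub>L\<^esub> [(- k)] \<cdot>\<^bsub>L\<^esub> \<one>\<^bsub>L\<^esub> = \<zero>\<^bsub>L\<^esub>"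
      unfolding L.int_embed_add[symmetric] by (simp add: L.int_embed_0)
    moreover have "h (k mod int p) \<oplus>\<^bsub>L\<^esub> [(- k)] \<cdot>\<^bsub>L\<^esub> \<one>\<^bsub>L\<^esub> = \<zero>\<^bsub>L\<^esub>"
      using nat[of "nat (- k)"] False h_add[of k "- k"] h0 by simp
    ultimately show ?thesis
      by (metis L.add.m_comm L.int_embed_closed L.minus_equality h_closed)
  qed
  show ?thesis
  proof
    fix k
    show "[k] \<cdot>\<^bsub>L\<^esub> \<one>\<^bsub>L\<^esub> = \<zero>\<^bsub>L\<^esub> \<longleftrightarrow> int p dvd k"
    proof
      assume z: "[k] \<cdot>\<^bsub>L\<^esub> \<one>\<^bsub>L\<^esub> = \<zero>\<^bsub>L\<^esub>"
      show "int p dvd k"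
      proof (rule ccontr)
        assume "\<not> int p dvd k"
        then have "coprime k (int p)"
          using assms(2) by (metis coprime_commute prime_imp_coprime prime_nat_int_transfer)
        then obtain m where "[k * m = 1] (mod (int p))" by (metis coprime_iff_invertible_int)
        then have "h ((k * m) mod int p) = \<one>\<^bsub>L\<^esub>" using p h1 by (simp add: cong_def)
        then show False using h_mult[of k m] z emb h_closed by simp
      qed
    qed (use emb h0 in auto)
  qed (use assms in auto)
qed

section \<open>The ring of residues modulo almost all primes\<close>

lemma product_ring_simps:
  "carrier (product_ring I R) = (\<Pi>\<^sub>E i\<in>I. carrier (R i))"
  "f \<otimes>\<^bsub>product_ring I R\<^esub> g = (\<lambda>i\<in>I. f i \<otimes>\<^bsub>R i\<^esub> g i)"
  "f \<oplus>\<^bsub>product_ring I R\<^esub> g = (\<lambda>i\<in>I. f i \<oplus>\<^bsub>R i\<^esub> g i)"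
  "\<one>\<^bsub>product_ring I R\<^esub> = (\<lambda>i\<in>I. \<one>\<^bsub>R i\<^esub>)"
  "\<zero>\<^bsub>product_ring I R\<^esub> = (\<lambda>i\<in>I. \<zero>\<^bsub>R i\<^esub>)"
  by (simp_all add: product_ring_def)

lemma cring_product_ring:
  assumes R: "\<And>i. i \<in> I \<Longrightarrow> cring (R i)"
  shows "cring (product_ring I R)"
proof -
  note rules = cring.cring_simprules[OF R] monoid.r_one[OF comm_monoid.axioms(1)[OF cring.axioms(2)[OF R]]]
  have ext: "(\<lambda>i\<in>I. h i) = f" if "f \<in> (\<Pi>\<^sub>E i\<in>I. carrier (R i))" "\<And>i. i \<in> I \<Longrightarrow> h i = f i" for h f
    using that by (auto simp: PiE_def extensional_def restrict_def)
  have mem: "f i \<in> carrier (R i)" if "f \<in> (\<Pi>\<^sub>E i\<in>I. carrier (R i))" "i \<in> I" for f i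
    using that by auto
  have neg: "\<exists>g\<in>carrier (product_ring I R). g \<oplus>\<^bsub>product_ring I R\<^esub> f = \<zero>\<^bsub>product_ring I R\<^esub>"
    if "f \<in> carrier (product_ring I R)" for f
  proof (rule bexI)
    show "(\<lambda>i\<in>I. \<ominus>\<^bsub>R i\<^esub> f i) \<oplus>\<^bsub>product_ring I R\<^esub> f = \<zero>\<^bsub>product_ring I R\<^esub>"
      using that by (auto simp: product_ring_simps rules mem intro!: restrict_ext)
    show "(\<lambda>i\<in>I. \<ominus>\<^bsub>R i\<^esub> f i) \<in> carrier (product_ring I R)"
      using that by (auto simp: product_ring_simps rules mem)
  qed
  show ?thesis
  proof (intro cringI abelian_groupI comm_monoidI neg)
  qed (auto simp: product_ring_simps rules mem intro!: restrict_ext ext)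
qed

lemma ideal_direct_sum_ideal:
  assumes R: "\<And>i. i \<in> I \<Longrightarrow> cring (R i)"
  shows "ideal (direct_sum_ideal I R) (product_ring I R)"
proof -
  interpret P: cring "product_ring I R" using R by (rule cring_product_ring)
  note rules = cring.cring_simprules[OF R]
  have mult: "f \<otimes>\<^bsub>product_ring I R\<^esub> g \<in> direct_sum_ideal I R"
    if "f \<in> direct_sum_ideal I R" "g \<in> carrier (product_ring I R)" for f g
  proof -
    have "g i \<in> carrier (R i)" if "i \<in> I" for i
      using \<open>g \<in> carrier (product_ring I R)\<close> that by (auto simp: product_ring_simps)
    then have "{i \<in> I. (f \<otimes>\<^bsub>product_ring I R\<^esub> g) i \<noteq> \<zero>\<^bsub>R i\<^esub>} \<subseteq> {i \<in> I. f i \<noteq> \<zero>\<^bsub>R i\<^esub>}"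
      by (auto simp: product_ring_simps rules)
    then show ?thesis using that by (auto simp: direct_sum_ideal_def intro: finite_subset)
  qed
  show ?thesis
  proof (rule idealI)
    show "subgroup (direct_sum_ideal I R) (add_monoid (product_ring I R))"
    proof (rule P.add.subgroupI)
      show "direct_sum_ideal I R \<subseteq> carrier (product_ring I R)" by (auto simp: direct_sum_ideal_def)
      have "\<zero>\<^bsub>product_ring I R\<^esub> \<in> direct_sum_ideal I R"
        by (simp add: direct_sum_ideal_def) (simp add: product_ring_simps)
      then show "direct_sum_ideal I R \<noteq> {}" by blast
    next
      fix f assume f: "f \<in> direct_sum_ideal I R"
      \<comment> \<open>Negation is multiplication by -1, so it is covered by closure under
        multiplication with the whole ring.\<close>
      then have "\<ominus>\<^bsub>product_ring I R\<^esub> f = f \<otimes>\<^bsub>product_ring I R\<^esub> (\<ominus>\<^bsub>product_ring I R\<^esub> \<one>\<^bsub>product_ring I R\<^esub>)"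
        by (simp add: direct_sum_ideal_def P.r_minus)
      then show "\<ominus>\<^bsub>product_ring I R\<^esub> f \<in> direct_sum_ideal I R" using mult[OF f] by simp
      fix g assume g: "g \<in> direct_sum_ideal I R"
      have "{i \<in> I. (f \<oplus>\<^bsub>product_ring I R\<^esub> g) i \<noteq> \<zero>\<^bsub>R i\<^esub>} \<subseteq> {i \<in> I. f i \<noteq> \<zero>\<^bsub>R i\<^esub>} \<union> {i \<in> I. g i \<noteq> \<zero>\<^bsub>R i\<^esub>}"
        by (auto simp: product_ring_simps rules)
      then show "f \<oplus>\<^bsub>product_ring I R\<^esub> g \<in> direct_sum_ideal I R"
        using f g by (auto simp: direct_sum_ideal_def intro: finite_subset)
    qed
  next
    fix f g assume fg: "f \<in> direct_sum_ideal I R" "g \<in> carrier (product_ring I R)"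
    then show "f \<otimes>\<^bsub>product_ring I R\<^esub> g \<in> direct_sum_ideal I R" by (rule mult)
    moreover have "f \<in> carrier (product_ring I R)" using fg(1) by (simp add: direct_sum_ideal_def)
    ultimately show "g \<otimes>\<^bsub>product_ring I R\<^esub> f \<in> direct_sum_ideal I R"
      using fg(2) by (simp add: P.m_comm)
  qed (rule P.ring_axioms)
qed

section \<open>Cosets in A(N) and functions representing complex numbers\<close>

locale finite_colored_mzv =
  fixes N :: nat and xi :: complex and L :: "nat \<Rightarrow> 'a ring" and x :: "nat \<Rightarrow> 'a"
  assumes N_pos: "N \<ge> 1"
    and xi_primitive: "primitive_root complex_ring N xi"
    and residue_field: "\<And>p. p \<in> PN N \<Longrightarrow> cyclotomic_residue_field (L p) N p (x p)"
begin

abbreviation prod_ring :: "(nat \<Rightarrow> 'a) ring" (\<open>\<P>\<close>) where "\<P> \<equiv> AN_product N L x"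
abbreviation quot_ring :: "(nat \<Rightarrow> 'a) set ring" (\<open>\<A>\<close>) where "\<A> \<equiv> AN_ring N L x"
abbreviation coset :: "(nat \<Rightarrow> 'a) \<Rightarrow> (nat \<Rightarrow> 'a) set" where
  "coset f \<equiv> AN_ideal N L x +>\<^bsub>\<P>\<^esub> f"

lemma ideal_AN: "ideal (AN_ideal N L x) \<P>"
  unfolding AN_ideal_def AN_product_def
  by (intro ideal_direct_sum_ideal cyclotomic_residue_field.cring_Fp_adjoin[OF residue_field])

lemma cring_prod_ring: "cring \<P>"
  unfolding AN_product_def
  by (intro cring_product_ring cyclotomic_residue_field.cring_Fp_adjoin[OF residue_field])

lemma cring_quot_ring: "cring \<A>"
  unfolding AN_ring_def using ideal_AN cring_prod_ring by (rule ideal.quotient_is_cring)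

sublocale P: cring \<P> by (rule cring_prod_ring)
sublocale I: ideal "AN_ideal N L x" \<P> by (rule ideal_AN)
sublocale Q: cring \<A> by (rule cring_quot_ring)

lemma prod_ring_simps:
  "carrier \<P> = (\<Pi>\<^sub>E p\<in>PN N. carrier (Fp_adjoin N (L p) (x p)))"
  "p \<in> PN N \<Longrightarrow> (f \<otimes>\<^bsub>\<P>\<^esub> g) p = f p \<otimes>\<^bsub>L p\<^esub> g p"
  "p \<in> PN N \<Longrightarrow> (f \<oplus>\<^bsub>\<P>\<^esub> g) p = f p \<oplus>\<^bsub>L p\<^esub> g p"
  "p \<in> PN N \<Longrightarrow> \<one>\<^bsub>\<P>\<^esub> p = \<one>\<^bsub>L p\<^esub>"
  "p \<in> PN N \<Longrightarrow> \<zero>\<^bsub>\<P>\<^esub> p = \<zero>\<^bsub>L p\<^esub>"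
  using cyclotomic_residue_field.Fp_adjoin_simps[OF residue_field]
  by (simp_all add: AN_product_def product_ring_simps)

lemma prod_ring_component_closed: "f \<in> carrier \<P> \<Longrightarrow> p \<in> PN N \<Longrightarrow> f p \<in> carrier (L p)"
  using cyclotomic_residue_field.Fp_adjoin_in_carrier[OF residue_field, of p "f p"]
  by (auto simp: prod_ring_simps)

lemma prod_ring_eqI:
  assumes "f \<in> carrier \<P>" "g \<in> carrier \<P>" "\<And>p. p \<in> PN N \<Longrightarrow> f p = g p"
  shows "f = g"
  using assms by (intro PiE_ext) (auto simp: prod_ring_simps(1))

lemma coset_closed [simp, intro]: "f \<in> carrier \<P> \<Longrightarrow> coset f \<in> carrier \<A>"
  using ring_hom_closed[OF I.rcos_ring_hom] by (simp add: AN_ring_def)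

lemma coset_add: "f \<in> carrier \<P> \<Longrightarrow> g \<in> carrier \<P> \<Longrightarrow> coset (f \<oplus>\<^bsub>\<P>\<^esub> g) = coset f \<oplus>\<^bsub>\<A>\<^esub> coset g"
  using ring_hom_add[OF I.rcos_ring_hom] by (simp add: AN_ring_def)

lemma coset_mult: "f \<in> carrier \<P> \<Longrightarrow> g \<in> carrier \<P> \<Longrightarrow> coset (f \<otimes>\<^bsub>\<P>\<^esub> g) = coset f \<otimes>\<^bsub>\<A>\<^esub> coset g"
  using ring_hom_mult[OF I.rcos_ring_hom] by (simp add: AN_ring_def)

lemma coset_one: "coset \<one>\<^bsub>\<P>\<^esub> = \<one>\<^bsub>\<A>\<^esub>"
  using ring_hom_one[OF I.rcos_ring_hom] by (simp add: AN_ring_def)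

lemma coset_zero: "coset \<zero>\<^bsub>\<P>\<^esub> = \<zero>\<^bsub>\<A>\<^esub>"
  using ring_hom_zero[OF I.rcos_ring_hom P.ring_axioms I.quotient_is_ring] by (simp add: AN_ring_def)

text \<open>The difference has finite support, hence lies in the direct sum.\<close>

lemma coset_eqI:
  assumes f: "f \<in> carrier \<P>" and g: "g \<in> carrier \<P>" and fin: "finite {p \<in> PN N. f p \<noteq> g p}"
  shows "coset f = coset g"
proof -
  define h where "h = f \<ominus>\<^bsub>\<P>\<^esub> g"
  have h: "h \<in> carrier \<P>" using f g by (simp add: h_def)
  have fh: "f = h \<oplus>\<^bsub>\<P>\<^esub> g" using f g by (simp add: h_def P.minus_eq P.a_assoc P.l_neg)
  have "h p = \<zero>\<^bsub>L p\<^esub>" if p: "p \<in> PN N" "f p = g p" for p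
  proof -
    interpret cyclotomic_residue_field "L p" N p "x p" using residue_field[OF p(1)] .
    have "h p \<oplus>\<^bsub>L p\<^esub> g p = g p" using arg_cong[OF fh, of "\<lambda>f. f p"] p by (simp add: prod_ring_simps)
    moreover have "h p \<in> carrier (L p)" "g p \<in> carrier (L p)"
      using h g p by (auto intro: prod_ring_component_closed)
    ultimately show ?thesis by simp
  qed
  then have "finite {p \<in> PN N. h p \<noteq> \<zero>\<^bsub>Fp_adjoin N (L p) (x p)\<^esub>}"
    using cyclotomic_residue_field.Fp_adjoin_simps(1)[OF residue_field]
    by (intro finite_subset[OF _ fin]) auto
  then have "h \<in> AN_ideal N L x"
    using h by (simp add: AN_ideal_def direct_sum_ideal_def AN_product_def)
  then have "f \<in> coset g" unfolding fh a_r_coset_def' by blast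
  then show ?thesis using P.a_repr_independence[OF _ g I.a_subgroup] by simp
qed

text \<open>
  Any integral polynomial \<open>f\<close> and denominator \<open>M\<close> with \<open>c = f(xi) / M\<close> are allowed here. Unlike
  the reduction of rational coefficients, this is visibly compatible with the ring operations.
\<close>

definition represents :: "complex \<Rightarrow> (nat \<Rightarrow> 'a) \<Rightarrow> bool" where
  "represents c g \<longleftrightarrow> g \<in> carrier \<P> \<and> (\<exists>M f. M \<noteq> 0 \<and> of_int M * c = int_eval f xi \<and>
     finite {p \<in> PN N. [(M::int)] \<cdot>\<^bsub>L p\<^esub> \<one>\<^bsub>L p\<^esub> \<otimes>\<^bsub>L p\<^esub> g p \<noteq> ring_eval (L p) (x p) f})"

lemma finite_prime_divisors: "M \<noteq> 0 \<Longrightarrow> finite {p. int p dvd M}"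
proof (rule finite_subset)
  assume "M \<noteq> 0"
  then show "{p. int p dvd M} \<subseteq> {..nat \<bar>M\<bar>}"
    by (auto dest!: dvd_imp_le_int)
qed simp

text \<open>Cross-multiplication: M' f - M f' vanishes at \<open>xi\<close>, hence at every
  \<open>x p\<close>. Outside the two finite exceptional sets and the prime divisors of M M', this
  lets M M' be cancelled, leaving \<open>g p = h p\<close>.\<close>

lemma coset_eq_of_represents:
  assumes g: "represents c g" and h: "represents c h"
  shows "coset g = coset h"
proof -
  obtain M f where M: "M \<noteq> 0" "of_int M * c = int_eval f xi"
    "finite {p \<in> PN N. [(M::int)] \<cdot>\<^bsub>L p\<^esub> \<one>\<^bsub>L p\<^esub> \<otimes>\<^bsub>L p\<^esub> g p \<noteq> ring_eval (L p) (x p) f}" (is "finite ?A")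
    using g unfolding represents_def by blast
  obtain M' f' where M': "M' \<noteq> 0" "of_int M' * c = int_eval f' xi"
    "finite {p \<in> PN N. [(M'::int)] \<cdot>\<^bsub>L p\<^esub> \<one>\<^bsub>L p\<^esub> \<otimes>\<^bsub>L p\<^esub> h p \<noteq> ring_eval (L p) (x p) f'}" (is "finite ?B")
    using h unfolding represents_def by blast
  have gh: "g \<in> carrier \<P>" "h \<in> carrier \<P>" using g h by (auto simp: represents_def)
  have "int_eval (Polynomial.smult M' f - Polynomial.smult M f') xi = 0"
    by (simp flip: M(2) M'(2))
  have "g p = h p" if p: "p \<in> PN N" "p \<notin> ?A" "p \<notin> ?B" "\<not> int p dvd M * M'" for p
  proof -
    interpret cyclotomic_residue_field "L p" N p "x p" using residue_field[OF p(1)] .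
    let ?e = "\<lambda>k::int. [k] \<cdot>\<^bsub>L p\<^esub> \<one>\<^bsub>L p\<^esub>"
    have cl: "g p \<in> carrier (L p)" "h p \<in> carrier (L p)" using gh p prod_ring_component_closed by auto
    have "ring_eval (L p) (x p) (Polynomial.smult M' f - Polynomial.smult M f') = \<zero>\<^bsub>L p\<^esub>"
      using ring_eval_eq_0[OF xi_primitive] \<open>int_eval _ xi = 0\<close> by blast
    then have "?e M' \<otimes>\<^bsub>L p\<^esub> ring_eval (L p) (x p) f = ?e M \<otimes>\<^bsub>L p\<^esub> ring_eval (L p) (x p) f'"
      by simp
    then have "?e M' \<otimes>\<^bsub>L p\<^esub> (?e M \<otimes>\<^bsub>L p\<^esub> g p) = ?e M \<otimes>\<^bsub>L p\<^esub> (?e M' \<otimes>\<^bsub>L p\<^esub> h p)"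
      using p by simp
    then have "?e (M * M') \<otimes>\<^bsub>L p\<^esub> g p = ?e (M * M') \<otimes>\<^bsub>L p\<^esub> h p"
      using cl by (simp add: int_embed_mult m_ac)
    then show ?thesis using cl p(4) int_embed_eq_0_iff[of "M * M'"] m_lcancel[of "?e (M * M')" "g p" "h p"] by simp
  qed
  then have "{p \<in> PN N. g p \<noteq> h p} \<subseteq> ?A \<union> ?B \<union> {p. int p dvd M * M'}" by blast
  moreover have "finite (?A \<union> ?B \<union> {p. int p dvd M * M'})"
    using M(1,3) M'(1,3) finite_prime_divisors[of "M * M'"] by simp
  ultimately show ?thesis using gh by (intro coset_eqI) (auto intro: finite_subset)
qed

lemma represents_int_eval:
  assumes "g \<in> carrier \<P>" "\<And>p. p \<in> PN N \<Longrightarrow> g p = ring_eval (L p) (x p) f" "c = int_eval f xi"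
  shows "represents c g"
proof -
  have one: "[(1::int)] \<cdot>\<^bsub>L p\<^esub> \<one>\<^bsub>L p\<^esub> \<otimes>\<^bsub>L p\<^esub> g p = ring_eval (L p) (x p) f" if "p \<in> PN N" for p
  proof -
    interpret cyclotomic_residue_field "L p" N p "x p" using residue_field[OF that] .
    show ?thesis using assms(1,2) that prod_ring_component_closed int_embed_1 by simp
  qed
  have "finite {p \<in> PN N. [(1::int)] \<cdot>\<^bsub>L p\<^esub> \<one>\<^bsub>L p\<^esub> \<otimes>\<^bsub>L p\<^esub> g p \<noteq> ring_eval (L p) (x p) f}"
    by (rule finite_subset[of _ "{}"]) (auto dest: one)
  moreover have "of_int 1 * c = int_eval f xi" using assms(3) by simp
  ultimately show ?thesis unfolding represents_def using assms(1) one_neq_zero by blast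
qed

lemma represents_0: "represents 0 \<zero>\<^bsub>\<P>\<^esub>"
proof (rule represents_int_eval[where f = 0])
  fix p assume "p \<in> PN N"
  then interpret cyclotomic_residue_field "L p" N p "x p" by (rule residue_field)
  show "\<zero>\<^bsub>\<P>\<^esub> p = ring_eval (L p) (x p) 0" using \<open>p \<in> PN N\<close> by (simp add: prod_ring_simps)
qed simp_all

lemma represents_1: "represents 1 \<one>\<^bsub>\<P>\<^esub>"
proof (rule represents_int_eval[where f = 1])
  fix p assume "p \<in> PN N"
  then interpret cyclotomic_residue_field "L p" N p "x p" by (rule residue_field)
  show "\<one>\<^bsub>\<P>\<^esub> p = ring_eval (L p) (x p) 1" using \<open>p \<in> PN N\<close> by (simp add: prod_ring_simps)
qed simp_all

lemma
  assumes g: "represents c g" and h: "represents d h"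
  shows represents_add: "represents (c + d) (g \<oplus>\<^bsub>\<P>\<^esub> h)"
    and represents_mult: "represents (c * d) (g \<otimes>\<^bsub>\<P>\<^esub> h)"
proof -
  obtain M f where M: "M \<noteq> 0" "of_int M * c = int_eval f xi"
    "finite {p \<in> PN N. [(M::int)] \<cdot>\<^bsub>L p\<^esub> \<one>\<^bsub>L p\<^esub> \<otimes>\<^bsub>L p\<^esub> g p \<noteq> ring_eval (L p) (x p) f}" (is "finite ?A")
    using g unfolding represents_def by blast
  obtain M' f' where M': "M' \<noteq> 0" "of_int M' * d = int_eval f' xi"
    "finite {p \<in> PN N. [(M'::int)] \<cdot>\<^bsub>L p\<^esub> \<one>\<^bsub>L p\<^esub> \<otimes>\<^bsub>L p\<^esub> h p \<noteq> ring_eval (L p) (x p) f'}" (is "finite ?B")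
    using h unfolding represents_def by blast
  have gh: "g \<in> carrier \<P>" "h \<in> carrier \<P>" using g h by (auto simp: represents_def)
  have fin: "finite (?A \<union> ?B)" using M(3) M'(3) by simp
  have add: "[(M * M'::int)] \<cdot>\<^bsub>L p\<^esub> \<one>\<^bsub>L p\<^esub> \<otimes>\<^bsub>L p\<^esub> (g \<oplus>\<^bsub>\<P>\<^esub> h) p =
        ring_eval (L p) (x p) (Polynomial.smult M' f + Polynomial.smult M f')" (is ?add)
    and mult: "[(M * M'::int)] \<cdot>\<^bsub>L p\<^esub> \<one>\<^bsub>L p\<^esub> \<otimes>\<^bsub>L p\<^esub> (g \<otimes>\<^bsub>\<P>\<^esub> h) p = ring_eval (L p) (x p) (f * f')" (is ?mult)
    if p: "p \<in> PN N" "p \<notin> ?A" "p \<notin> ?B" for p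
  proof -
    interpret cyclotomic_residue_field "L p" N p "x p" using residue_field[OF p(1)] .
    let ?e = "\<lambda>k::int. [k] \<cdot>\<^bsub>L p\<^esub> \<one>\<^bsub>L p\<^esub>"
    have cl: "g p \<in> carrier (L p)" "h p \<in> carrier (L p)" using gh p prod_ring_component_closed by auto
    have ev: "ring_eval (L p) (x p) f = ?e M \<otimes>\<^bsub>L p\<^esub> g p" "ring_eval (L p) (x p) f' = ?e M' \<otimes>\<^bsub>L p\<^esub> h p"
      using p by auto
    have ids: "(a \<otimes>\<^bsub>L p\<^esub> b) \<otimes>\<^bsub>L p\<^esub> (u \<oplus>\<^bsub>L p\<^esub> v) = b \<otimes>\<^bsub>L p\<^esub> (a \<otimes>\<^bsub>L p\<^esub> u) \<oplus>\<^bsub>L p\<^esub> a \<otimes>\<^bsub>L p\<^esub> (b \<otimes>\<^bsub>L p\<^esub> v)"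
      "(a \<otimes>\<^bsub>L p\<^esub> b) \<otimes>\<^bsub>L p\<^esub> (u \<otimes>\<^bsub>L p\<^esub> v) = (a \<otimes>\<^bsub>L p\<^esub> u) \<otimes>\<^bsub>L p\<^esub> (b \<otimes>\<^bsub>L p\<^esub> v)"
      if "a \<in> carrier (L p)" "b \<in> carrier (L p)" "u \<in> carrier (L p)" "v \<in> carrier (L p)" for a b u v
      using that by algebra+
    show ?add using p cl by (simp add: prod_ring_simps int_embed_mult ev ids)
    show ?mult using p cl by (simp add: prod_ring_simps int_embed_mult ev ids)
  qed
  have "of_int (M * M') * (c + d) = int_eval (Polynomial.smult M' f + Polynomial.smult M f') xi"
    "of_int (M * M') * (c * d) = int_eval (f * f') xi"
    by (simp_all add: algebra_simps flip: M(2) M'(2))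
  moreover have
    "finite {p \<in> PN N. [(M * M'::int)] \<cdot>\<^bsub>L p\<^esub> \<one>\<^bsub>L p\<^esub> \<otimes>\<^bsub>L p\<^esub> (g \<oplus>\<^bsub>\<P>\<^esub> h) p \<noteq>
        ring_eval (L p) (x p) (Polynomial.smult M' f + Polynomial.smult M f')}"
    "finite {p \<in> PN N. [(M * M'::int)] \<cdot>\<^bsub>L p\<^esub> \<one>\<^bsub>L p\<^esub> \<otimes>\<^bsub>L p\<^esub> (g \<otimes>\<^bsub>\<P>\<^esub> h) p \<noteq> ring_eval (L p) (x p) (f * f')}"
    using add mult by (intro finite_subset[OF _ fin]; blast)+
  moreover have "M * M' \<noteq> 0" using M M' by simp
  ultimately show "represents (c + d) (g \<oplus>\<^bsub>\<P>\<^esub> h)" "represents (c * d) (g \<otimes>\<^bsub>\<P>\<^esub> h)"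
    unfolding represents_def using gh by (blast intro: P.a_closed P.m_closed)+
qed

text \<open>A common denominator \<open>D\<close> of the coefficients serves as \<open>M\<close>.
  The exceptional primes, in particular all those where \<open>rat_red\<close> falls back on zero,
  are among the divisors of \<open>D\<close>.\<close>

lemma represents_rat_red:
  fixes a :: "nat \<Rightarrow> rat"
  assumes c: "c = (\<Sum>j<N. of_rat (a j) * xi ^ j)"
  shows "represents c (\<lambda>p\<in>PN N. \<Oplus>\<^bsub>L p\<^esub>j\<in>{..<N}. rat_red p (L p) (a j) \<otimes>\<^bsub>L p\<^esub> (x p [^]\<^bsub>L p\<^esub> j))"
proof -
  let ?g = "\<lambda>p. \<Oplus>\<^bsub>L p\<^esub>j\<in>{..<N}. rat_red p (L p) (a j) \<otimes>\<^bsub>L p\<^esub> (x p [^]\<^bsub>L p\<^esub> j)"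
  obtain D :: nat where D: "D > 0" "\<forall>r\<in>a ` {..<N}. \<exists>n. of_nat D * r = of_int n"
    using common_denominator[of "a ` {..<N}"] by auto
  then have "\<exists>n. of_nat D * a j = of_int n" if "j < N" for j using that by blast
  then obtain n where n: "\<And>j. j < N \<Longrightarrow> of_nat D * a j = of_int (n j)" by metis
  define f where "f = (\<Sum>j<N. Polynomial.monom (n j) j)"
  have "of_int (int D) * c = (\<Sum>j<N. of_rat (of_nat D * a j) * xi ^ j)"
    by (simp add: c sum_distrib_left of_rat_mult mult_ac)
  also have "\<dots> = (\<Sum>j<N. of_int (n j) * xi ^ j)"
    by (intro sum.cong) (simp_all add: n)
  also have "\<dots> = int_eval f xi" by (simp add: f_def)
  finally have "of_int (int D) * c = int_eval f xi" .
  moreover have red: "?g p \<in> carrier (Fp_adjoin N (L p) (x p)) \<and>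
      (\<not> int p dvd int D \<longrightarrow> [(int D)] \<cdot>\<^bsub>L p\<^esub> \<one>\<^bsub>L p\<^esub> \<otimes>\<^bsub>L p\<^esub> ?g p = ring_eval (L p) (x p) f)"
    if p: "p \<in> PN N" for p
  proof -
    interpret cyclotomic_residue_field "L p" N p "x p" using residue_field[OF p] .
    interpret F: cring "Fp_adjoin N (L p) (x p)" by (rule cring_Fp_adjoin)
    have mem: "rat_red p (L p) (a j) \<otimes>\<^bsub>L p\<^esub> (x p [^]\<^bsub>L p\<^esub> j) \<in> carrier (Fp_adjoin N (L p) (x p))" for j
      by (intro Fp_adjoin_subcringE(6) rat_red_in_Fp_adjoin pow_in_Fp_adjoin y_in_Fp_adjoin)
    then have cl: "rat_red p (L p) (a j) \<otimes>\<^bsub>L p\<^esub> (x p [^]\<^bsub>L p\<^esub> j) \<in> carrier (L p)" for j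
      by (rule Fp_adjoin_in_carrier)
    have rcl: "rat_red p (L p) (a j) \<in> carrier (L p)" for j
      by (intro Fp_adjoin_in_carrier rat_red_in_Fp_adjoin)
    have "(\<Oplus>\<^bsub>L p\<^esub>j\<in>J. rat_red p (L p) (a j) \<otimes>\<^bsub>L p\<^esub> (x p [^]\<^bsub>L p\<^esub> j)) \<in> carrier (Fp_adjoin N (L p) (x p))"
      if "finite J" for J
      using that
    proof (induction J rule: finite_induct)
      case (insert j J)
      then show ?case using cl mem by (simp add: Fp_adjoin_subcringE(7))
    qed (simp add: Fp_adjoin_subcringE(2))
    moreover have "[(int D)] \<cdot>\<^bsub>L p\<^esub> \<one>\<^bsub>L p\<^esub> \<otimes>\<^bsub>L p\<^esub> ?g p = ring_eval (L p) (x p) f" if nd: "\<not> int p dvd int D"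
    proof -
      have "[(int D)] \<cdot>\<^bsub>L p\<^esub> \<one>\<^bsub>L p\<^esub> \<otimes>\<^bsub>L p\<^esub> ?g p =
          (\<Oplus>\<^bsub>L p\<^esub>j\<in>{..<N}. [(int D)] \<cdot>\<^bsub>L p\<^esub> \<one>\<^bsub>L p\<^esub> \<otimes>\<^bsub>L p\<^esub> (rat_red p (L p) (a j) \<otimes>\<^bsub>L p\<^esub> (x p [^]\<^bsub>L p\<^esub> j)))"
        using cl by (intro finsum_rdistr) auto
      also have "\<dots> = (\<Oplus>\<^bsub>L p\<^esub>j\<in>{..<N}. [(n j)] \<cdot>\<^bsub>L p\<^esub> \<one>\<^bsub>L p\<^esub> \<otimes>\<^bsub>L p\<^esub> (x p [^]\<^bsub>L p\<^esub> j))"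
      proof (intro finsum_cong')
        fix j assume "j \<in> {..<N}"
        then have "[(int D)] \<cdot>\<^bsub>L p\<^esub> \<one>\<^bsub>L p\<^esub> \<otimes>\<^bsub>L p\<^esub> rat_red p (L p) (a j) = [(n j)] \<cdot>\<^bsub>L p\<^esub> \<one>\<^bsub>L p\<^esub>"
          using n nd by (intro int_embed_mult_rat_red) auto
        then show "[(int D)] \<cdot>\<^bsub>L p\<^esub> \<one>\<^bsub>L p\<^esub> \<otimes>\<^bsub>L p\<^esub> (rat_red p (L p) (a j) \<otimes>\<^bsub>L p\<^esub> (x p [^]\<^bsub>L p\<^esub> j)) =
            [(n j)] \<cdot>\<^bsub>L p\<^esub> \<one>\<^bsub>L p\<^esub> \<otimes>\<^bsub>L p\<^esub> (x p [^]\<^bsub>L p\<^esub> j)"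
          using rcl by (metis int_embed_closed m_assoc nat_pow_closed y_closed)
      qed auto
      also have "\<dots> = ring_eval (L p) (x p) f" by (simp add: f_def ring_eval_sum)
      finally show ?thesis .
    qed
    ultimately show ?thesis by blast
  qed
  moreover have "(\<lambda>p\<in>PN N. ?g p) \<in> carrier \<P>" using red by (simp add: prod_ring_simps)
  moreover have "finite {p \<in> PN N. [(int D)] \<cdot>\<^bsub>L p\<^esub> \<one>\<^bsub>L p\<^esub> \<otimes>\<^bsub>L p\<^esub> (\<lambda>p\<in>PN N. ?g p) p \<noteq> ring_eval (L p) (x p) f}"
    using D(1) red by (intro finite_subset[OF _ finite_prime_divisors[of "int D"]]) auto
  moreover have "int D \<noteq> 0" using D(1) by simp
  ultimately show ?thesis unfolding represents_def by blast
qed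

text \<open>Justifies the definite description: every rational representation of \<open>c\<close>
  yields a function representing \<open>c\<close>, and all these have the same coset.\<close>

lemma AN_embed_eq:
  assumes c: "represents c g" and a: "c = (\<Sum>j<N. of_rat (a j) * xi ^ j)"
  shows "AN_embed N xi L x c = coset g"
  unfolding AN_embed_def
proof (rule the_equality)
  have eq: "AN_class N L x (\<lambda>p. \<Oplus>\<^bsub>L p\<^esub>j\<in>{..<N}. rat_red p (L p) (b j) \<otimes>\<^bsub>L p\<^esub> (x p [^]\<^bsub>L p\<^esub> j)) = coset g"
    if "c = (\<Sum>j<N. of_rat (b j) * xi ^ j)" for b
    unfolding AN_class_def by (rule coset_eq_of_represents[OF represents_rat_red[OF that] c])
  show "\<exists>a. c = (\<Sum>j<N. of_rat (a j) * xi ^ j) \<and> coset g =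
      AN_class N L x (\<lambda>p. \<Oplus>\<^bsub>L p\<^esub>j\<in>{..<N}. rat_red p (L p) (a j) \<otimes>\<^bsub>L p\<^esub> (x p [^]\<^bsub>L p\<^esub> j))"
    by (intro exI[of _ a] conjI a eq[OF a, symmetric])
  show "Y = coset g" if "\<exists>a. c = (\<Sum>j<N. of_rat (a j) * xi ^ j) \<and> Y =
      AN_class N L x (\<lambda>p. \<Oplus>\<^bsub>L p\<^esub>j\<in>{..<N}. rat_red p (L p) (a j) \<otimes>\<^bsub>L p\<^esub> (x p [^]\<^bsub>L p\<^esub> j))" for Y
  proof -
    from that obtain b where b: "c = (\<Sum>j<N. of_rat (b j) * xi ^ j)"
      "Y = AN_class N L x (\<lambda>p. \<Oplus>\<^bsub>L p\<^esub>j\<in>{..<N}. rat_red p (L p) (b j) \<otimes>\<^bsub>L p\<^esub> (x p [^]\<^bsub>L p\<^esub> j))"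
      by blast
    show ?thesis unfolding b(2) by (rule eq[OF b(1)])
  qed
qed

end

section \<open>The coefficient field\<close>

lemma int_eval_eq_sum:
  assumes "N \<ge> 1" "z ^ N = 1"
  shows "\<exists>a :: nat \<Rightarrow> int. int_eval f z = (\<Sum>j<N. of_int (a j) * z ^ j)"
proof -
  obtain q r where f: "f = (Polynomial.monom 1 N - 1) * q + r" and r: "Polynomial.degree r < N"
    using division_by_monom_diff_1[OF assms(1)] .
  have "int_eval f z = int_eval r z" using assms(2) by (simp add: f)
  also have "r = (\<Sum>j<N. Polynomial.monom (Polynomial.coeff r j) j)"
    using poly_as_sum_of_monoms'[of r "N - 1"] r assms(1) lessThan_Suc_atMost[of "N - 1"] by simp
  also have "int_eval \<dots> z = (\<Sum>j<N. of_int (Polynomial.coeff r j) * z ^ j)" by simp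
  finally show ?thesis by blast
qed

text \<open>
  If \<open>d\<close> has least degree among the polynomials whose value at \<open>z\<close> is a nonzero multiple of \<open>f(z)\<close>,
  then division of the minimal polynomial of \<open>z\<close> by \<open>d\<close> shows that \<open>d\<close> is constant.
\<close>

lemma int_eval_divides_int:
  assumes z: "int_eval m0 z = 0" "m0 \<noteq> 0" and f: "int_eval f z \<noteq> 0"
  shows "\<exists>g K. K \<noteq> 0 \<and> int_eval f z * int_eval g z = of_int K"
proof -
  \<comment> \<open>Up to a rational factor this is the minimal polynomial of \<open>z\<close>;
    choosing it by least degree keeps all coefficients integral.\<close>
  obtain m where m: "m \<noteq> 0" "int_eval m z = 0"
    and m_min: "\<And>g. g \<noteq> 0 \<Longrightarrow> int_eval g z = 0 \<Longrightarrow> Polynomial.degree m \<le> Polynomial.degree g"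
    using exists_least_iff[of "\<lambda>n. \<exists>g. g \<noteq> 0 \<and> int_eval g z = 0 \<and> Polynomial.degree g = n"] z
    by (metis linorder_not_less)
  define S where "S = {d. int_eval d z \<noteq> 0 \<and> (\<exists>u. int_eval d z = int_eval f z * int_eval u z)}"
  have "f \<in> S" using f by (auto simp: S_def intro: exI[of _ 1])
  then obtain d where d: "d \<in> S" and d_min: "\<And>g. g \<in> S \<Longrightarrow> Polynomial.degree d \<le> Polynomial.degree g"
    using exists_least_iff[of "\<lambda>n. \<exists>g. g \<in> S \<and> Polynomial.degree g = n"]
    by (metis linorder_not_less)
  obtain u where u: "int_eval d z = int_eval f z * int_eval u z" using d by (auto simp: S_def)
  have d0: "d \<noteq> 0" "int_eval d z \<noteq> 0" using d by (auto simp: S_def)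
  have "Polynomial.degree d = 0"
  proof (rule ccontr)
    assume nc: "Polynomial.degree d \<noteq> 0"
    obtain q r where qr: "pseudo_divmod m d = (q, r)" by fastforce
    define c where "c = Polynomial.coeff d (Polynomial.degree d) ^ (Suc (Polynomial.degree m) - Polynomial.degree d)"
    have div: "Polynomial.smult c m = d * q + r" "r = 0 \<or> Polynomial.degree r < Polynomial.degree d"
      using pseudo_divmod[OF d0(1) qr] by (auto simp: c_def)
    have c: "c \<noteq> 0" using d0(1) by (simp add: c_def)
    have eq: "int_eval d z * int_eval q z + int_eval r z = 0"
      using arg_cong[OF div(1), of "\<lambda>f. int_eval f z"] m by simp
    \<comment> \<open>The value of \<open>r\<close> at \<open>z\<close> is again a multiple of f(z).
      Were it nonzero, \<open>r\<close> would belong to \<open>S\<close> with smaller degree than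
      \<open>d\<close>.\<close>
    have "int_eval r z = 0"
    proof (rule ccontr)
      assume "int_eval r z \<noteq> 0"
      moreover have "int_eval r z = int_eval f z * int_eval (- u * q) z"
        using eq u by (simp add: algebra_simps add_eq_0_iff2)
      ultimately have "r \<in> S" by (auto simp only: S_def)
      then show False using d_min[of r] div(2) \<open>int_eval r z \<noteq> 0\<close> by auto
    qed
    then have q: "int_eval q z = 0" using eq d0 by simp
    have "r = 0 \<or> Polynomial.degree m \<le> Polynomial.degree r" using m_min \<open>int_eval r z = 0\<close> by blast
    \<comment> \<open>Reducing \<open>d\<close> modulo \<open>m\<close> changes its value only by
      the nonzero factor \<open>c'\<close>, so the remainder stays in \<open>S\<close>. By
      minimality \<open>d\<close> has at most its degree, which is below that of
      \<open>m\<close>.\<close>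
    have dm: "Polynomial.degree d < Polynomial.degree m"
    proof -
      obtain q' r' where qr': "pseudo_divmod d m = (q', r')" by fastforce
      define c' where "c' = Polynomial.coeff m (Polynomial.degree m) ^ (Suc (Polynomial.degree d) - Polynomial.degree m)"
      have div': "Polynomial.smult c' d = m * q' + r'" "r' = 0 \<or> Polynomial.degree r' < Polynomial.degree m"
        using pseudo_divmod[OF m(1) qr'] by (auto simp: c'_def)
      have c': "c' \<noteq> 0" using m(1) by (simp add: c'_def)
      have r': "int_eval r' z = of_int c' * int_eval d z"
        using arg_cong[OF div'(1), of "\<lambda>f. int_eval f z"] m by simp
      then have "int_eval r' z = int_eval f z * int_eval (Polynomial.smult c' u) z"
        using u by simp
      moreover have "int_eval r' z \<noteq> 0" using r' c' d0 by simp
      ultimately have "r' \<in> S" by (auto simp only: S_def)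
      then have "Polynomial.degree d \<le> Polynomial.degree r'" by (rule d_min)
      then show ?thesis using div'(2) \<open>int_eval r' z \<noteq> 0\<close> by auto
    qed
    \<comment> \<open>\<open>r\<close> vanishes at \<open>z\<close> and has smaller degree than
      \<open>m\<close>, so it is 0. Then \<open>q\<close> also vanishes at \<open>z\<close>, and as
      \<open>d\<close> is not constant it has smaller degree than \<open>m\<close>: a
      contradiction.\<close>
    have "r = 0" using \<open>r = 0 \<or> Polynomial.degree m \<le> Polynomial.degree r\<close> div(2) dm by linarith
    then have eq': "Polynomial.smult c m = d * q" using div(1) by simp
    then have "q \<noteq> 0" using c m(1) by auto
    then have "Polynomial.degree m = Polynomial.degree d + Polynomial.degree q"
      using arg_cong[OF eq', of Polynomial.degree] c d0 by (simp add: degree_mult_eq)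
    then show False using m_min[OF \<open>q \<noteq> 0\<close> q] nc by simp
  qed
  then obtain K where K: "d = [:K:]" by (rule degree_eq_zeroE)
  show ?thesis using K u d0 by (intro exI[of _ u] exI[of _ K]) auto
qed

section \<open>Elements of K as fractions with integer denominator\<close>

lemma complex_ring_simps:
  "\<one>\<^bsub>complex_ring\<^esub> = 1" "\<zero>\<^bsub>complex_ring\<^esub> = 0" "carrier complex_ring = UNIV"
  "a \<oplus>\<^bsub>complex_ring\<^esub> b = a + b" "a \<otimes>\<^bsub>complex_ring\<^esub> b = a * b"
  by (simp_all add: ring_of_type_algebra_def)

lemma complex_ring_uminus: "\<ominus>\<^bsub>complex_ring\<^esub> a = - (a::complex)"
proof -
  interpret field complex_ring by (rule field_from_type_algebra)
  have "- a \<oplus>\<^bsub>complex_ring\<^esub> a = \<zero>\<^bsub>complex_ring\<^esub>" by (simp add: complex_ring_simps)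
  then show ?thesis by (intro minus_equality) (auto simp: complex_ring_simps)
qed

lemma complex_ring_inv: "a \<noteq> 0 \<Longrightarrow> inv\<^bsub>complex_ring\<^esub> a = inverse (a::complex)"
proof -
  assume "a \<noteq> 0"
  interpret field complex_ring by (rule field_from_type_algebra)
  show ?thesis using \<open>a \<noteq> 0\<close> by (intro comm_inv_char) (auto simp: complex_ring_simps)
qed

lemma cyc_field_add: "c \<in> cyc_field N \<Longrightarrow> d \<in> cyc_field N \<Longrightarrow> c + d \<in> cyc_field N"
  and cyc_field_mult: "c \<in> cyc_field N \<Longrightarrow> d \<in> cyc_field N \<Longrightarrow> c * d \<in> cyc_field N"
  and cyc_field_1: "1 \<in> cyc_field N"
  unfolding cyc_field_def
  using generate_field.eng_add[of c complex_ring _ d] generate_field.eng_mult[of c complex_ring _ d]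
    generate_field.one[of complex_ring]
  by (simp_all add: complex_ring_simps)

lemma cyc_field_0: "0 \<in> cyc_field N"
  using cyc_field_add[OF cyc_field_1] generate_field.a_inv[OF generate_field.one, of complex_ring]
  by (metis add.right_inverse complex_ring_simps(1) complex_ring_uminus cyc_field_def)

text \<open>Only inversion needs an idea: with M h = f(xi) and f(xi) g(xi) = K for a nonzero integer
  K, the inverse of h is M g(xi) / K.\<close>

lemma cyc_field_fraction:
  assumes N: "N \<ge> 1" and xi: "primitive_root complex_ring N xi" and c: "c \<in> cyc_field N"
  shows "\<exists>M f. M \<noteq> 0 \<and> of_int M * c = int_eval f xi"
  using c unfolding cyc_field_def
proof (induction rule: generate_field.induct)
  case one
  show ?case by (intro exI[of _ "1::int"] exI[of _ "1::int poly"]) (simp add: complex_ring_simps)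
next
  case (incl h)
  then obtain e where "h = xi ^ e" using Gamma_eq_powers[OF N xi] by auto
  then show ?case by (intro exI[of _ "1::int"] exI[of _ "Polynomial.monom 1 e"]) simp
next
  case (a_inv h)
  then obtain M f where "M \<noteq> 0" "of_int M * h = int_eval f xi" by blast
  then show ?case by (intro exI[of _ M] exI[of _ "- f"]) (simp add: complex_ring_uminus)
next
  case (m_inv h)
  then obtain M f where M: "M \<noteq> 0" "of_int M * h = int_eval f xi" by blast
  have h: "h \<noteq> 0" using m_inv by (simp add: complex_ring_simps)
  have "xi ^ N = 1" using xi by (simp add: primitive_root_complex_ring_iff)
  then have "int_eval (Polynomial.monom 1 N - 1) xi = 0" by simp
  moreover have "Polynomial.coeff (Polynomial.monom 1 N - 1 :: int poly) N = 1" using N by simp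
  then have "(Polynomial.monom 1 N - 1 :: int poly) \<noteq> 0" by (metis coeff_0 zero_neq_one)
  ultimately obtain g K where g: "K \<noteq> 0" "int_eval f xi * int_eval g xi = of_int K"
    using int_eval_divides_int[of "Polynomial.monom 1 N - 1" xi f] M h by (metis mult_eq_0_iff of_int_eq_0_iff)
  have "of_int K * inverse h = int_eval (Polynomial.smult M g) xi"
    using h by (simp flip: g(2) M(2))
  then show ?case using g(1) h
    by (intro exI[of _ K] exI[of _ "Polynomial.smult M g"]) (simp add: complex_ring_inv)
next
  case (eng_add h k)
  then obtain M f M' f' where "M \<noteq> 0" "of_int M * h = int_eval f xi" "M' \<noteq> 0" "of_int M' * k = int_eval f' xi"
    by blast
  then show ?case
    by (intro exI[of _ "M * M'"] exI[of _ "Polynomial.smult M' f + Polynomial.smult M f'"])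
      (simp add: complex_ring_simps algebra_simps)
next
  case (eng_mult h k)
  then obtain M f M' f' where M: "M \<noteq> 0" "of_int M * h = int_eval f xi" "M' \<noteq> 0" "of_int M' * k = int_eval f' xi"
    by blast
  have "of_int (M * M') * (h * k) = int_eval (f * f') xi"
    by (simp add: mult_ac flip: M(2,4))
  then show ?case using M(1,3)
    by (intro exI[of _ "M * M'"] exI[of _ "f * f'"]) (simp add: complex_ring_simps)
qed

text \<open>Supplies the existence half of the definite description in
  \<open>AN_embed\<close>.\<close>

lemma cyc_field_rat_combination:
  assumes N: "N \<ge> 1" and xi: "primitive_root complex_ring N xi" and c: "c \<in> cyc_field N"
  shows "\<exists>a :: nat \<Rightarrow> rat. c = (\<Sum>j<N. of_rat (a j) * xi ^ j)"
proof -
  obtain M f where M: "M \<noteq> 0" "of_int M * c = int_eval f xi" using cyc_field_fraction[OF assms] by blast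
  have "xi ^ N = 1" using xi by (simp add: primitive_root_complex_ring_iff)
  then obtain b :: "nat \<Rightarrow> int" where b: "int_eval f xi = (\<Sum>j<N. of_int (b j) * xi ^ j)"
    using int_eval_eq_sum[OF N] by blast
  have "c = (\<Sum>j<N. of_rat (of_int (b j) / of_int M) * xi ^ j)"
    using M(1) M(2)[symmetric] b by (simp add: of_rat_divide field_simps flip: sum_divide_distrib)
  then show ?thesis by (rule exI[of _ "\<lambda>j. of_int (b j) / of_int M"])
qed

section \<open>The embedding of K into A(N) and the values of words\<close>

context finite_colored_mzv begin

abbreviation embed :: "complex \<Rightarrow> (nat \<Rightarrow> 'a) set" where "embed \<equiv> AN_embed N xi L x"

text \<open>Any representing function computes the embedding. Sums and products of representing
  functions are therefore enough for the homomorphism laws.\<close>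

lemma embed_eq: "c \<in> cyc_field N \<Longrightarrow> represents c g \<Longrightarrow> embed c = coset g"
  using cyc_field_rat_combination[OF N_pos xi_primitive] AN_embed_eq by blast

lemma represents_exists: "c \<in> cyc_field N \<Longrightarrow> \<exists>g. represents c g"
  using cyc_field_rat_combination[OF N_pos xi_primitive] represents_rat_red by blast

lemma represents_carrier: "represents c g \<Longrightarrow> g \<in> carrier \<P>"
  by (simp add: represents_def)

lemma embed_closed [simp, intro]: "c \<in> cyc_field N \<Longrightarrow> embed c \<in> carrier \<A>"
  using represents_exists embed_eq represents_carrier coset_closed by metis

lemma embed_0 [simp]: "embed 0 = \<zero>\<^bsub>\<A>\<^esub>"
  using embed_eq[OF cyc_field_0 represents_0] by (simp add: coset_zero)

lemma embed_1 [simp]: "embed 1 = \<one>\<^bsub>\<A>\<^esub>"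
  using embed_eq[OF cyc_field_1 represents_1] by (simp add: coset_one)

lemma embed_add:
  assumes "c \<in> cyc_field N" "d \<in> cyc_field N"
  shows "embed (c + d) = embed c \<oplus>\<^bsub>\<A>\<^esub> embed d"
proof -
  obtain g h where gh: "represents c g" "represents d h" using assms represents_exists by meson
  show ?thesis
    using embed_eq[OF cyc_field_add[OF assms] represents_add[OF gh]] gh assms
    by (simp add: embed_eq coset_add represents_carrier)
qed

lemma embed_mult:
  assumes "c \<in> cyc_field N" "d \<in> cyc_field N"
  shows "embed (c * d) = embed c \<otimes>\<^bsub>\<A>\<^esub> embed d"
proof -
  obtain g h where gh: "represents c g" "represents d h" using assms represents_exists by meson
  show ?thesis
    using embed_eq[OF cyc_field_mult[OF assms] represents_mult[OF gh]] gh assms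
    by (simp add: embed_eq coset_mult represents_carrier)
qed

lemma AN_simps:
  "carrier (AN N xi L x) = carrier \<A>" "\<one>\<^bsub>AN N xi L x\<^esub> = \<one>\<^bsub>\<A>\<^esub>" "\<zero>\<^bsub>AN N xi L x\<^esub> = \<zero>\<^bsub>\<A>\<^esub>"
  "Y \<otimes>\<^bsub>AN N xi L x\<^esub> Z = Y \<otimes>\<^bsub>\<A>\<^esub> Z" "Y \<oplus>\<^bsub>AN N xi L x\<^esub> Z = Y \<oplus>\<^bsub>\<A>\<^esub> Z"
  "c \<odot>\<^bsub>AN N xi L x\<^esub> Y = embed c \<otimes>\<^bsub>\<A>\<^esub> Y"
  by (simp_all add: AN_def ring.defs module.defs)

lemma AN_finsum: "finsum (AN N xi L x) h A = finsum \<A> h A"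
  by (simp add: finsum_def finprod_def AN_def ring.defs module.defs)

definition word_fun :: "word \<Rightarrow> nat \<Rightarrow> 'a" where
  "word_fun w = (\<lambda>p\<in>PN N. fcmzv_component N xi p (L p) (x p) (map fst w) (map snd w))"

definition word_value :: "word \<Rightarrow> (nat \<Rightarrow> 'a) set" where
  "word_value w = coset (word_fun w)"

lemma word_fun_apply:
  "p \<in> PN N \<Longrightarrow> word_fun w p = cyclotomic_residue_field.word_component (L p) N (x p) xi p w"
  using cyclotomic_residue_field.word_component_def[OF residue_field] by (simp add: word_fun_def)

lemma word_fun_closed [simp, intro]: "word_fun w \<in> carrier \<P>"
proof -
  have "word_fun w p \<in> carrier (Fp_adjoin N (L p) (x p))" if "p \<in> PN N" for p
    unfolding word_fun_apply[OF that]
    by (rule cyclotomic_residue_field.word_component_in_Fp_adjoin[OF residue_field[OF that] order.refl])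
  then show ?thesis by (auto simp: prod_ring_simps word_fun_def)
qed

lemma word_value_closed [simp, intro]: "word_value w \<in> carrier \<A>"
  by (simp add: word_value_def coset_closed)

lemma word_value_eq_fcmzv: "word_value w = fcmzv N xi L x (map fst w) (map snd w)"
  by (simp add: word_value_def fcmzv_def AN_class_def word_fun_def)

text \<open>In depth 0 the only tuple is the empty one and its term is 1, so the convention for the
  empty word in \<open>zeta_star\<close> agrees with the general formula.\<close>

lemma word_value_Nil: "word_value [] = \<one>\<^bsub>\<A>\<^esub>"
proof -
  have "word_fun [] = \<one>\<^bsub>\<P>\<^esub>"
  proof (rule prod_ring_eqI)
    fix p assume p: "p \<in> PN N"
    show "word_fun [] p = \<one>\<^bsub>\<P>\<^esub> p"
      using p cyclotomic_residue_field.word_component_Nil[OF residue_field[OF p]]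
      by (simp add: word_fun_apply prod_ring_simps)
  qed auto
  then show ?thesis by (simp add: word_value_def coset_one)
qed

text \<open>The relation holds in the full product, at every prime with bound \<open>n = p\<close>;
  the passage to the quotient only applies a ring homomorphism.\<close>

lemma word_value_stuffle:
  assumes uv: "u \<in> lists (letters N)" "v \<in> lists (letters N)"
  shows "word_value u \<otimes>\<^bsub>\<A>\<^esub> word_value v = list_sum \<A> word_value (stuffle_list u v)"
proof -
  have apply_sum: "list_sum \<P> word_fun ws p = list_sum (L p) (\<lambda>w. word_fun w p) ws" if "p \<in> PN N" for ws p
    using that by (induction ws) (simp_all add: list_sum_def prod_ring_simps)
  have "word_fun u \<otimes>\<^bsub>\<P>\<^esub> word_fun v = list_sum \<P> word_fun (stuffle_list u v)"
  proof (rule prod_ring_eqI)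
    fix p assume p: "p \<in> PN N"
    then interpret cyclotomic_residue_field "L p" N p "x p" by (rule residue_field)
    have "list_sum (L p) (\<lambda>w. word_fun w p) (stuffle_list u v) = list_sum (L p) (word_component xi p) (stuffle_list u v)"
      using p by (simp add: word_fun_apply)
    then show "(word_fun u \<otimes>\<^bsub>\<P>\<^esub> word_fun v) p = list_sum \<P> word_fun (stuffle_list u v) p"
      using p word_component_stuffle[OF xi_primitive order.refl uv]
      by (simp add: prod_ring_simps apply_sum word_fun_apply)
  qed auto
  then have "word_value u \<otimes>\<^bsub>\<A>\<^esub> word_value v = coset (list_sum \<P> word_fun (stuffle_list u v))"
    by (simp add: word_value_def flip: coset_mult)
  also have "coset (list_sum \<P> word_fun ws) = list_sum \<A> word_value ws" for ws
    by (induction ws) (simp_all add: coset_zero coset_add word_value_def)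
  finally show ?thesis .
qed

end

section \<open>The stuffle algebra\<close>

text \<open>Cancellation can make the support of a sum smaller than the union of the supports. A
  common index set makes additivity a termwise matter.\<close>

lemma prepend_superset:
  assumes "finite A" "Poly_Mapping.keys f \<subseteq> A"
  shows "prepend a f = (\<Sum>w\<in>A. Poly_Mapping.single (a # w) (Poly_Mapping.lookup f w))"
  unfolding prepend_def using assms
  by (intro sum.mono_neutral_left) (auto simp: in_keys_iff)

lemma prepend_add: "prepend a (f + g) = prepend a f + prepend a g"
proof -
  let ?A = "Poly_Mapping.keys f \<union> Poly_Mapping.keys g"
  have A: "finite ?A" by simp
  show ?thesis
    unfolding prepend_superset[OF A Poly_Mapping.keys_add] prepend_superset[OF A Un_upper1]
      prepend_superset[OF A Un_upper2]
    by (simp add: lookup_add single_add sum.distrib)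
qed

lemma prepend_single: "prepend a (Poly_Mapping.single w c) = Poly_Mapping.single (a # w) c"
  by (cases "c = 0") (simp_all add: prepend_def)

abbreviation word_poly :: "word \<Rightarrow> ncpoly" where
  "word_poly w \<equiv> Poly_Mapping.single w 1"

lemma prepend_sum_list_words:
  "prepend a (sum_list (map word_poly ws)) = sum_list (map word_poly (map ((#) a) ws))"
proof (induction ws)
  case Nil
  show ?case by (simp add: prepend_def)
qed (simp add: prepend_add prepend_single)

text \<open>Links the product with complex coefficients to the list with multiplicities, for which
  the relation is known.\<close>

lemma stuffle_words_eq: "stuffle_words u v = sum_list (map word_poly (stuffle_list u v))"
proof (induction u v rule: stuffle_list.induct)
  case (3 m mu u n nu v)
  then show ?case
    by (simp only: stuffle_words.simps stuffle_list.simps map_append sum_list_append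
        prepend_sum_list_words add.assoc)
qed simp_all

lemma lookup_scale [simp]: "Poly_Mapping.lookup (scale c f) w = c * Poly_Mapping.lookup f w"
  by (simp add: scale_def Poly_Mapping.map.rep_eq when_def)

lemma keys_scale_subset: "Poly_Mapping.keys (scale c f) \<subseteq> Poly_Mapping.keys f"
  by (auto simp: in_keys_iff)

lemma mem_stuffle_algebra_iff:
  "f \<in> carrier (stuffle_algebra N) \<longleftrightarrow>
    Poly_Mapping.keys f \<subseteq> lists (letters N) \<and> (\<forall>w. Poly_Mapping.lookup f w \<in> cyc_field N)"
proof -
  have "Poly_Mapping.lookup f w \<in> cyc_field N" if "w \<notin> Poly_Mapping.keys f" for w
    using that cyc_field_0 by (simp add: in_keys_iff)
  then show ?thesis unfolding stuffle_algebra_def by auto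
qed

lemma stuffle_algebra_0: "0 \<in> carrier (stuffle_algebra N)"
  by (simp add: mem_stuffle_algebra_iff cyc_field_0)

lemma stuffle_algebra_add:
  "f \<in> carrier (stuffle_algebra N) \<Longrightarrow> g \<in> carrier (stuffle_algebra N) \<Longrightarrow> f + g \<in> carrier (stuffle_algebra N)"
  unfolding mem_stuffle_algebra_iff lookup_add
  by (intro conjI allI cyc_field_add subset_trans[OF Poly_Mapping.keys_add] Un_least) simp_all

lemma stuffle_algebra_scale:
  "c \<in> cyc_field N \<Longrightarrow> f \<in> carrier (stuffle_algebra N) \<Longrightarrow> scale c f \<in> carrier (stuffle_algebra N)"
  unfolding mem_stuffle_algebra_iff lookup_scale
  by (intro conjI allI cyc_field_mult subset_trans[OF keys_scale_subset]) simp_all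

lemma stuffle_algebra_word: "w \<in> lists (letters N) \<Longrightarrow> word_poly w \<in> carrier (stuffle_algebra N)"
  by (simp add: mem_stuffle_algebra_iff lookup_single when_def cyc_field_0 cyc_field_1)

lemma stuffle_algebra_sum:
  "(\<And>i. i \<in> A \<Longrightarrow> h i \<in> carrier (stuffle_algebra N)) \<Longrightarrow> (\<Sum>i\<in>A. h i) \<in> carrier (stuffle_algebra N)"
  by (induction A rule: infinite_finite_induct) (auto intro: stuffle_algebra_0 stuffle_algebra_add)

lemma stuffle_algebra_sum_list:
  "set ws \<subseteq> lists (letters N) \<Longrightarrow> sum_list (map word_poly ws) \<in> carrier (stuffle_algebra N)"
  by (induction ws) (auto intro: stuffle_algebra_0 stuffle_algebra_add stuffle_algebra_word simp del: in_lists_conv_set)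

lemma stuffle_algebra_stuffle_words:
  "u \<in> lists (letters N) \<Longrightarrow> v \<in> lists (letters N) \<Longrightarrow> stuffle_words u v \<in> carrier (stuffle_algebra N)"
  unfolding stuffle_words_eq using stuffle_list_in_letters by (intro stuffle_algebra_sum_list) blast

section \<open>Linearity and multiplicativity of the map on noncommutative polynomials\<close>

context finite_colored_mzv begin

abbreviation zeta :: "ncpoly \<Rightarrow> (nat \<Rightarrow> 'a) set" where "zeta \<equiv> zeta_star N xi L x"

lemma zeta_eq: "zeta f = (\<Oplus>\<^bsub>\<A>\<^esub>w\<in>Poly_Mapping.keys f. embed (Poly_Mapping.lookup f w) \<otimes>\<^bsub>\<A>\<^esub> word_value w)"
proof -
  have "(if w = [] then \<one>\<^bsub>\<A>\<^esub> else fcmzv N xi L x (map fst w) (map snd w)) = word_value w" for w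
    by (simp add: word_value_Nil flip: word_value_eq_fcmzv)
  then show ?thesis unfolding zeta_star_def AN_finsum AN_simps by simp
qed

lemma zeta_superset:
  assumes f: "f \<in> carrier (stuffle_algebra N)" and A: "finite A" "Poly_Mapping.keys f \<subseteq> A"
  shows "zeta f = (\<Oplus>\<^bsub>\<A>\<^esub>w\<in>A. embed (Poly_Mapping.lookup f w) \<otimes>\<^bsub>\<A>\<^esub> word_value w)"
  unfolding zeta_eq
proof (rule Q.add.finprod_mono_neutral_cong_left[OF A])
  fix w assume "w \<in> A - Poly_Mapping.keys f"
  then show "embed (Poly_Mapping.lookup f w) \<otimes>\<^bsub>\<A>\<^esub> word_value w = \<zero>\<^bsub>\<A>\<^esub>"
    by (simp add: in_keys_iff)
qed (use f in \<open>auto simp: mem_stuffle_algebra_iff\<close>)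

lemma zeta_closed:
  assumes "f \<in> carrier (stuffle_algebra N)"
  shows "zeta f \<in> carrier \<A>"
  unfolding zeta_eq using assms by (intro Q.finsum_closed) (auto simp: mem_stuffle_algebra_iff)

lemma zeta_add:
  assumes f: "f \<in> carrier (stuffle_algebra N)" and g: "g \<in> carrier (stuffle_algebra N)"
  shows "zeta (f + g) = zeta f \<oplus>\<^bsub>\<A>\<^esub> zeta g"
proof -
  let ?A = "Poly_Mapping.keys f \<union> Poly_Mapping.keys g"
  have fg: "Poly_Mapping.lookup f w \<in> cyc_field N" "Poly_Mapping.lookup g w \<in> cyc_field N" for w
    using f g by (auto simp: mem_stuffle_algebra_iff)
  have "zeta (f + g) = (\<Oplus>\<^bsub>\<A>\<^esub>w\<in>?A. embed (Poly_Mapping.lookup (f + g) w) \<otimes>\<^bsub>\<A>\<^esub> word_value w)"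
    by (rule zeta_superset) (simp_all add: stuffle_algebra_add f g Poly_Mapping.keys_add)
  also have "\<dots> = (\<Oplus>\<^bsub>\<A>\<^esub>w\<in>?A. embed (Poly_Mapping.lookup f w) \<otimes>\<^bsub>\<A>\<^esub> word_value w \<oplus>\<^bsub>\<A>\<^esub>
      embed (Poly_Mapping.lookup g w) \<otimes>\<^bsub>\<A>\<^esub> word_value w)"
    using fg by (intro Q.finsum_cong') (auto simp: lookup_add embed_add Q.l_distr)
  also have "\<dots> = (\<Oplus>\<^bsub>\<A>\<^esub>w\<in>?A. embed (Poly_Mapping.lookup f w) \<otimes>\<^bsub>\<A>\<^esub> word_value w) \<oplus>\<^bsub>\<A>\<^esub>
      (\<Oplus>\<^bsub>\<A>\<^esub>w\<in>?A. embed (Poly_Mapping.lookup g w) \<otimes>\<^bsub>\<A>\<^esub> word_value w)"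
    using fg by (intro Q.finsum_addf) auto
  also have "\<dots> = zeta f \<oplus>\<^bsub>\<A>\<^esub> zeta g"
    using zeta_superset[OF f, of ?A] zeta_superset[OF g, of ?A] by simp
  finally show ?thesis .
qed

lemma zeta_0: "zeta 0 = \<zero>\<^bsub>\<A>\<^esub>"
  by (simp add: zeta_eq)

lemma zeta_scale:
  assumes c: "c \<in> cyc_field N" and f: "f \<in> carrier (stuffle_algebra N)"
  shows "zeta (scale c f) = embed c \<otimes>\<^bsub>\<A>\<^esub> zeta f"
proof -
  have fw: "Poly_Mapping.lookup f w \<in> cyc_field N" for w
    using f by (auto simp: mem_stuffle_algebra_iff)
  have "zeta (scale c f) =
      (\<Oplus>\<^bsub>\<A>\<^esub>w\<in>Poly_Mapping.keys f. embed (Poly_Mapping.lookup (scale c f) w) \<otimes>\<^bsub>\<A>\<^esub> word_value w)"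
    by (intro zeta_superset stuffle_algebra_scale assms keys_scale_subset) simp
  also have "\<dots> = (\<Oplus>\<^bsub>\<A>\<^esub>w\<in>Poly_Mapping.keys f. embed c \<otimes>\<^bsub>\<A>\<^esub> (embed (Poly_Mapping.lookup f w) \<otimes>\<^bsub>\<A>\<^esub> word_value w))"
    using fw c by (intro Q.finsum_cong') (auto simp: embed_mult Q.m_assoc)
  also have "\<dots> = embed c \<otimes>\<^bsub>\<A>\<^esub> zeta f"
    unfolding zeta_eq using fw c by (intro Q.finsum_rdistr[symmetric]) auto
  finally show ?thesis .
qed

lemma zeta_word: "zeta (word_poly w) = word_value w"
  by (simp add: zeta_eq)

lemma zeta_sum:
  assumes "finite A" "\<And>i. i \<in> A \<Longrightarrow> h i \<in> carrier (stuffle_algebra N)"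
  shows "zeta (\<Sum>i\<in>A. h i) = (\<Oplus>\<^bsub>\<A>\<^esub>i\<in>A. zeta (h i))"
  using assms
proof (induction A rule: finite_induct)
  case (insert i A)
  then have "(\<Oplus>\<^bsub>\<A>\<^esub>i\<in>insert i A. zeta (h i)) = zeta (h i) \<oplus>\<^bsub>\<A>\<^esub> (\<Oplus>\<^bsub>\<A>\<^esub>i\<in>A. zeta (h i))"
    by (intro Q.finsum_insert) (auto intro: zeta_closed)
  then show ?case using insert by (simp add: zeta_add stuffle_algebra_sum)
qed (simp add: zeta_0)

lemma zeta_sum_list:
  "set ws \<subseteq> lists (letters N) \<Longrightarrow> zeta (sum_list (map word_poly ws)) = list_sum \<A> word_value ws"
proof (induction ws)
  case (Cons w ws)
  then have "word_poly w \<in> carrier (stuffle_algebra N)"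
    "sum_list (map word_poly ws) \<in> carrier (stuffle_algebra N)"
    by (auto intro!: stuffle_algebra_word stuffle_algebra_sum_list simp del: in_lists_conv_set)
  then show ?case using Cons by (simp add: zeta_add zeta_word)
qed (simp add: zeta_0)

lemma zeta_stuffle_words:
  assumes "u \<in> lists (letters N)" "v \<in> lists (letters N)"
  shows "zeta (stuffle_words u v) = word_value u \<otimes>\<^bsub>\<A>\<^esub> word_value v"
proof -
  have "set (stuffle_list u v) \<subseteq> lists (letters N)"
    using stuffle_list_in_letters[OF assms] by blast
  then show ?thesis
    by (simp only: stuffle_words_eq zeta_sum_list word_value_stuffle[OF assms])
qed

text \<open>Bilinear expansion reduces the claim to pairs of words. The coefficient of a pair is a
  product in \<open>K\<close>, and it splits into the two scalars because \<open>embed\<close> is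
  multiplicative.\<close>

lemma zeta_stuffle:
  assumes f: "f \<in> carrier (stuffle_algebra N)" and g: "g \<in> carrier (stuffle_algebra N)"
  shows "zeta (stuffle f g) = zeta f \<otimes>\<^bsub>\<A>\<^esub> zeta g"
proof -
  let ?F = "Poly_Mapping.keys f" and ?G = "Poly_Mapping.keys g"
  let ?a = "\<lambda>u. embed (Poly_Mapping.lookup f u) \<otimes>\<^bsub>\<A>\<^esub> word_value u"
  let ?b = "\<lambda>v. embed (Poly_Mapping.lookup g v) \<otimes>\<^bsub>\<A>\<^esub> word_value v"
  let ?t = "\<lambda>u v. scale (Poly_Mapping.lookup f u * Poly_Mapping.lookup g v) (stuffle_words u v)"
  have co: "Poly_Mapping.lookup f w \<in> cyc_field N" "Poly_Mapping.lookup g w \<in> cyc_field N" for w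
    using f g by (auto simp: mem_stuffle_algebra_iff)
  have ab: "?a w \<in> carrier \<A>" "?b w \<in> carrier \<A>" for w using co by auto
  have mem: "u \<in> lists (letters N)" if "u \<in> ?F \<union> ?G" for u
    using f g that by (auto simp: mem_stuffle_algebra_iff simp del: in_lists_conv_set)
  have tmem: "?t u v \<in> carrier (stuffle_algebra N)" if "u \<in> ?F" "v \<in> ?G" for u v
    using that mem co by (intro stuffle_algebra_scale stuffle_algebra_stuffle_words cyc_field_mult) auto
  have t: "zeta (?t u v) = ?a u \<otimes>\<^bsub>\<A>\<^esub> ?b v" if "u \<in> ?F" "v \<in> ?G" for u v
  proof -
    have uv: "u \<in> lists (letters N)" "v \<in> lists (letters N)" using mem that by blast+
    have "zeta (?t u v) = (embed (Poly_Mapping.lookup f u) \<otimes>\<^bsub>\<A>\<^esub> embed (Poly_Mapping.lookup g v)) \<otimes>\<^bsub>\<A>\<^esub>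
        (word_value u \<otimes>\<^bsub>\<A>\<^esub> word_value v)"
      by (simp only: zeta_scale[OF cyc_field_mult[OF co] stuffle_algebra_stuffle_words[OF uv]]
          zeta_stuffle_words[OF uv] embed_mult[OF co])
    also have "\<dots> = ?a u \<otimes>\<^bsub>\<A>\<^esub> ?b v"
      using co by (simp add: Q.m_ac)
    finally show ?thesis .
  qed
  have "zeta (stuffle f g) = (\<Oplus>\<^bsub>\<A>\<^esub>u\<in>?F. zeta (\<Sum>v\<in>?G. ?t u v))"
    unfolding stuffle_def using tmem by (intro zeta_sum stuffle_algebra_sum) auto
  also have "\<dots> = (\<Oplus>\<^bsub>\<A>\<^esub>u\<in>?F. ?a u \<otimes>\<^bsub>\<A>\<^esub> zeta g)"
  proof (rule Q.finsum_cong'[OF refl])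
    fix u assume u: "u \<in> ?F"
    have "zeta (\<Sum>v\<in>?G. ?t u v) = (\<Oplus>\<^bsub>\<A>\<^esub>v\<in>?G. zeta (?t u v))"
      using tmem u by (intro zeta_sum) auto
    also have "\<dots> = (\<Oplus>\<^bsub>\<A>\<^esub>v\<in>?G. ?a u \<otimes>\<^bsub>\<A>\<^esub> ?b v)"
      by (rule Q.finsum_cong'[OF refl]) (use ab in \<open>auto simp: t[OF u]\<close>)
    also have "\<dots> = ?a u \<otimes>\<^bsub>\<A>\<^esub> zeta g"
      unfolding zeta_eq[of g] by (rule Q.finsum_rdistr[symmetric]) (use ab in auto)
    finally show "zeta (\<Sum>v\<in>?G. ?t u v) = ?a u \<otimes>\<^bsub>\<A>\<^esub> zeta g" .
  qed (use ab zeta_closed[OF g] in auto)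
  also have "\<dots> = zeta f \<otimes>\<^bsub>\<A>\<^esub> zeta g"
    unfolding zeta_eq[of f] by (rule Q.finsum_ldistr[symmetric]) (use ab zeta_closed[OF g] in auto)
  finally show ?thesis .
qed

end

theorem theorem3p2:
  fixes N :: nat and xi :: complex and L :: "nat \<Rightarrow> 'a ring" and x :: "nat \<Rightarrow> 'a"
  assumes "N \<ge> 1"
    and "primitive_root complex_ring N xi"
    and "\<And>p. p \<in> PN N \<Longrightarrow> is_alg_closure_of (residue_ring (int p)) (L p)"
    and "\<And>p. p \<in> PN N \<Longrightarrow> primitive_root (L p) N (x p)"
  shows "zeta_star N xi L x (Poly_Mapping.single [] 1) = \<one>\<^bsub>AN N xi L x\<^esub>
    \<and> (\<forall>w \<in> lists (letters N). w \<noteq> [] \<longrightarrow>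
         zeta_star N xi L x (Poly_Mapping.single w 1) = fcmzv N xi L x (map fst w) (map snd w))
    \<and> (\<forall>c \<in> cyc_field N. \<forall>u \<in> carrier (stuffle_algebra N).
         zeta_star N xi L x (c \<odot>\<^bsub>stuffle_algebra N\<^esub> u) = c \<odot>\<^bsub>AN N xi L x\<^esub> zeta_star N xi L x u)
    \<and> zeta_star N xi L x \<in> ring_hom (stuffle_algebra N) (AN N xi L x)"
proof -
  interpret finite_colored_mzv N xi L x
    by (intro finite_colored_mzv.intro cyclotomic_residue_fieldI assms) (simp_all add: PN_def)
  have ops: "\<one>\<^bsub>stuffle_algebra N\<^esub> = word_poly []" "f \<otimes>\<^bsub>stuffle_algebra N\<^esub> g = stuffle f g"
    "f \<oplus>\<^bsub>stuffle_algebra N\<^esub> g = f + g" "c \<odot>\<^bsub>stuffle_algebra N\<^esub> f = scale c f" for f g c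
    by (simp_all add: stuffle_algebra_def)
  have "zeta \<in> ring_hom (stuffle_algebra N) (AN N xi L x)"
    by (rule ring_hom_memI)
      (simp_all add: AN_simps ops zeta_closed zeta_add zeta_stuffle zeta_word word_value_Nil)
  moreover have "zeta (word_poly []) = \<one>\<^bsub>\<A>\<^esub>" by (simp add: zeta_word word_value_Nil)
  ultimately show ?thesis
    by (simp add: AN_simps ops zeta_scale) (simp add: zeta_word word_value_eq_fcmzv)
qed

end
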